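(* Let $p$ be a prime, $q\in\mathbb{C}_p$ with $|q-1|_p<p^{-\frac{1}{p-1}}$, $\lambda\in\mathbb{C}_p\setminus\{0\}$, and $x\in\mathbb{Z}_p$. For every integer $n\ge0$ and every $m\in\mathbb{N}$, \[ \beta_{n,q}(x|\lambda)=\sum_{l=0}^n\sum_{i=0}^{m-1}S_1(n,l)\lambda^{n-l}[m]_q^{l-1}q^i\beta_{l,q^m}\!\left(\frac{x+i}{m}\right). \]
   Context: $q^x=\exp(x\log q)$, $[x]_q=\frac{1-q^x}{1-q}$. For $Q\in\mathbb{C}_p$ with $|Q-1|_p<p^{-1/(p-1)}$, the $p$-adic $Q$-integral of a uniformly differentiable $f$ on $\mathbb{Z}_p$ is $\int_{\mathbb{Z}_p}f(y)\,d\mu_Q(y)=\lim_{N\to\infty}\frac{1}{[p^N]_Q}\sum_{y=0}^{p^N-1}f(y)Q^y$. The Carlitz $q$-Bernoulli polynomials are $\beta_{l,q}(x)=\int_{\mathbb{Z}_p}[x+y]_q^l\,d\mu_q(y)$; here $\beta_{l,q^m}\big(\frac{x+i}{m}\big)=\int_{\mathbb{Z}_p}\big[\frac{x+i}{m}+y\big]_{q^m}^l\,d\mu_{q^m}(y)$ with $\big[\frac{x+i}{m}+y\big]_{q^m}=\frac{1-q^{x+i+my}}{1-q^m}$. For $t\in\mathbb{C}_p$ with $|\lambda t|_p<p^{-1/(p-1)}$, $(1+\lambda t)^{a/\lambda}=\exp(\frac{a}{\lambda}\log(1+\lambda t))$, and the degenerate Carlitz $q$-Bernoulli polynomials $\beta_{n,q}(x|\lambda)$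 are defined by $\int_{\mathbb{Z}_p}(1+\lambda t)^{\frac{1}{\lambda}[x+y]_q}\,d\mu_q(y)=\sum_{n\ge0}\beta_{n,q}(x|\lambda)\frac{t^n}{n!}$. $S_1(n,l)$ are the (signed) Stirling numbers of the first kind: $x(x-1)\cdots(x-n+1)=\sum_{l=0}^nS_1(n,l)x^l$. *)

theory Defs
  imports "HOL-Analysis.Analysis" "HOL-Computational_Algebra.Computational_Algebra"
begin

text \<open>
  Fields of characteristic zero with a non-archimedean absolute value, metrized by it.  The
  library's \<^const>\<open>norm\<close> is only available on real vector spaces, which excludes p-adic fields.
\<close>

class nonarch_field = field_char_0 + metric_space +
  fixes vabs :: "'a \<Rightarrow> real"
  assumes dist_vabs: "dist x y = vabs (x - y)"
    and vabs_mult: "vabs (x * y) = vabs x * vabs y"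
    and vabs_add: "vabs (x + y) \<le> max (vabs x) (vabs y)"

definition padic_rationals :: "'a::nonarch_field set" where
  "padic_rationals = closure \<rat>"

definition padic_integers :: "'a::nonarch_field set" where
  "padic_integers = {x \<in> padic_rationals. vabs x \<le> 1}"

definition padic_algebraic :: "'a::nonarch_field set" where
  "padic_algebraic =
     {z. \<exists>f. f \<noteq> 0 \<and> (\<forall>i. coeff f i \<in> padic_rationals) \<and> poly f z = 0}"

text \<open>
  The type \<open>'a\<close> is (a copy of) \<open>\<complex>\<^sub>p\<close>, the completion of an algebraic closure of
  \<open>\<rat>\<^sub>p\<close>: its absolute value restricts to the p-adic one on the rationals and it is
  complete (so the closure of the rationals is \<open>\<rat>\<^sub>p\<close>), and the elements algebraic over
  \<open>\<rat>\<^sub>p\<close> form an algebraically closed field that is dense.  This determines \<open>'a\<close> up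
  to isometric isomorphism.
\<close>

definition padic_complex_field :: "nat \<Rightarrow> 'a::nonarch_field itself \<Rightarrow> bool" where
  "padic_complex_field p _ \<longleftrightarrow>
     (\<forall>k. k > 0 \<longrightarrow> vabs (of_nat k :: 'a) = 1 / real p ^ multiplicity p k) \<and>
     complete (UNIV :: 'a set) \<and>
     (\<forall>f :: 'a poly. degree f > 0 \<and> (\<forall>i. coeff f i \<in> padic_algebraic) \<longrightarrow>
        (\<exists>z \<in> padic_algebraic. poly f z = 0)) \<and>
     closure (padic_algebraic :: 'a set) = UNIV"

definition conv_radius_exp :: "nat \<Rightarrow> real" where
  "conv_radius_exp p = real p powr (- 1 / (real p - 1))"

definition padic_exp :: "'a::nonarch_field \<Rightarrow> 'a" where
  "padic_exp z = (\<Sum>k. z ^ k / fact k)"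

definition padic_log :: "'a::nonarch_field \<Rightarrow> 'a" where
  "padic_log u = (\<Sum>k. (- 1) ^ k * (u - 1) ^ Suc k / of_nat (Suc k))"

definition padic_power :: "'a::nonarch_field \<Rightarrow> 'a \<Rightarrow> 'a" where
  "padic_power u a = padic_exp (a * padic_log u)"

text \<open>
  At \<open>q = 1\<close>, where the quotient is undefined, the usual limit value \<open>[x]\<^sub>1 = x\<close> is taken.
\<close>

definition q_number :: "'a::nonarch_field \<Rightarrow> 'a \<Rightarrow> 'a" where
  "q_number q x = (if q = 1 then x else (1 - padic_power q x) / (1 - q))"

definition padic_q_integral :: "nat \<Rightarrow> 'a::nonarch_field \<Rightarrow> ('a \<Rightarrow> 'a) \<Rightarrow> 'a" where
  "padic_q_integral p Q f =
     lim (\<lambda>N. 1 / q_number Q (of_nat (p ^ N)) * (\<Sum>y = 0..<p ^ N. f (of_nat y) * Q ^ y))"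

definition carlitz_q_bernoulli :: "nat \<Rightarrow> nat \<Rightarrow> 'a::nonarch_field \<Rightarrow> 'a \<Rightarrow> 'a" where
  "carlitz_q_bernoulli p l q x = padic_q_integral p q (\<lambda>y. q_number q (x + y) ^ l)"

text \<open>
  The generating identity is required for all \<open>t\<close> at which the integrand is defined:
  \<open>\<bar>\<lambda>t\<bar> < p\<^bsup>-1/(p-1)\<^esup>\<close> takes care of the logarithm, where \<open>\<bar>log (1 + \<lambda>t)\<bar> = \<bar>\<lambda>t\<bar>\<close>, so
  for \<open>\<bar>[x + y]\<^sub>q\<bar> = 1\<close> the exponential series converges only if also \<open>\<bar>t\<bar> < p\<^bsup>-1/(p-1)\<^esup>\<close>
  (an extra condition only if \<open>\<bar>\<lambda>\<bar> < 1\<close>).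
\<close>

definition degenerate_carlitz_q_bernoulli ::
    "nat \<Rightarrow> nat \<Rightarrow> 'a::nonarch_field \<Rightarrow> 'a \<Rightarrow> 'a \<Rightarrow> 'a" where
  "degenerate_carlitz_q_bernoulli p n q x lam =
     (THE b :: nat \<Rightarrow> 'a.
        \<forall>t. vabs (lam * t) < conv_radius_exp p \<and> vabs t < conv_radius_exp p \<longrightarrow>
          (\<lambda>k. b k * (t ^ k / fact k)) sums
            padic_q_integral p q (\<lambda>y. padic_power (1 + lam * t) (1 / lam * q_number q (x + y)))) n"

text \<open>
  Signed Stirling numbers of the first kind, as the coefficients of the falling factorial
  \<open>X (X - 1) \<dots> (X - n + 1)\<close>.
\<close>

definition signed_stirling1 :: "nat \<Rightarrow> nat \<Rightarrow> int" where
  "signed_stirling1 n l = coeff (\<Prod>j<n. [:- int j, 1:]) l"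

end

theory Submission
  imports Defs
begin

unbundle no vec_syntax

text \<open>
  Expanding \<open>exp ([x + y] z)\<close> with \<open>z = log (1 + \<lambda>t) / \<lambda>\<close> and integrating term by term gives
  \<open>\<Sum> \<beta>\<^sub>l z\<^sup>l / l!\<close>, because the Riemann sums of \<open>[x + y]\<^sup>l\<close> are bounded by \<open>p\<close> uniformly in \<open>l\<close>: the
  integrand is 1-Lipschitz in \<open>y\<close>.  Since \<open>log (1 + w)\<^sup>l / l! = \<Sum> S\<^sub>1(n, l) w\<^sup>n / n!\<close>, exchanging the two
  sums identifies the coefficients as \<open>\<beta>\<^sub>n(x | \<lambda>) = \<Sum> S\<^sub>1(n, l) \<lambda>\<^sup>n\<^sup>-\<^sup>l \<beta>\<^sub>l(x)\<close>.  It remains to apply the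
  distribution relation for \<open>\<beta>\<^sub>l\<close>: splitting a sum over \<open>z < m p\<^sup>N\<close> into residue classes modulo \<open>m\<close>
  gives its right-hand side, and the limit along \<open>m p\<^sup>N\<close> agrees with the limit along \<open>p\<^sup>N\<close> because
  \<open>\<Sum>\<^bsub>y<M\<^esub> [x + y]\<^sup>l q\<^sup>y\<close> is \<open>[M]\<close> times a polynomial in \<open>[M]\<close>.
\<close>

section \<open>Non-archimedean absolute values and series\<close>

lemma vabs_nonneg [simp]: "0 \<le> vabs (x :: 'a::nonarch_field)"
  using dist_vabs[of x 0] by (metis diff_zero zero_le_dist)

lemma vabs_eq_0_iff [simp]: "vabs (x :: 'a::nonarch_field) = 0 \<longleftrightarrow> x = 0"
  using dist_vabs[of x 0] by (metis diff_zero dist_eq_0_iff)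

lemma vabs_0 [simp]: "vabs (0 :: 'a::nonarch_field) = 0"
  by simp

lemma vabs_gt_0_iff [simp]: "0 < vabs (x :: 'a::nonarch_field) \<longleftrightarrow> x \<noteq> 0"
  using vabs_nonneg[of x] vabs_eq_0_iff[of x] by linarith

lemma vabs_1 [simp]: "vabs (1 :: 'a::nonarch_field) = 1"
  using vabs_mult[of "1::'a" 1] vabs_eq_0_iff[of "1::'a"] by simp

lemma vabs_minus [simp]: "vabs (- x :: 'a::nonarch_field) = vabs x"
  using dist_vabs[of 0 x] dist_vabs[of x 0] by (simp add: dist_commute)

lemma vabs_minus_commute: "vabs (x - y :: 'a::nonarch_field) = vabs (y - x)"
  using vabs_minus[of "x - y"] by simp

lemma vabs_diff: "vabs (x - y :: 'a::nonarch_field) \<le> max (vabs x) (vabs y)"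
  using vabs_add[of x "- y"] by simp

lemma vabs_add_le:
  "vabs (x :: 'a::nonarch_field) \<le> C \<Longrightarrow> vabs y \<le> C \<Longrightarrow> vabs (x + y) \<le> C"
  using vabs_add[of x y] by simp

lemma vabs_diff_le:
  "vabs (x :: 'a::nonarch_field) \<le> C \<Longrightarrow> vabs y \<le> C \<Longrightarrow> vabs (x - y) \<le> C"
  using vabs_diff[of x y] by simp

lemma vabs_power: "vabs (x ^ n :: 'a::nonarch_field) = vabs x ^ n"
  by (induction n) (simp_all add: vabs_mult)

lemma vabs_inverse: "vabs (inverse x :: 'a::nonarch_field) = inverse (vabs x)"
proof (cases "x = 0")
  case False
  then have "vabs x * vabs (inverse x) = 1"
    by (simp flip: vabs_mult)
  then show ?thesis
    by (metis inverse_unique)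
qed simp

lemma vabs_divide: "vabs (x / y :: 'a::nonarch_field) = vabs x / vabs y"
  by (simp add: divide_inverse vabs_mult vabs_inverse)

lemma vabs_sum_le:
  fixes f :: "'b \<Rightarrow> 'a::nonarch_field"
  assumes "\<And>i. i \<in> A \<Longrightarrow> vabs (f i) \<le> C" "0 \<le> C"
  shows "vabs (sum f A) \<le> C"
  using assms by (induction A rule: infinite_finite_induct) (auto intro!: vabs_add_le)

lemma vabs_of_nat_le_1 [simp]: "vabs (of_nat n :: 'a::nonarch_field) \<le> 1"
  by (induction n) (auto intro!: vabs_add_le)

lemma vabs_of_int_le_1 [simp]: "vabs (of_int n :: 'a::nonarch_field) \<le> 1"
  by (cases n) (auto simp del: of_nat_Suc)

text \<open>The isosceles triangle principle: were the sum smaller than \<open>y\<close>, then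
  \<open>y = (x + y) - x\<close> would be too small as well.\<close>

lemma vabs_add_eq_right:
  assumes "vabs (x :: 'a::nonarch_field) < vabs y"
  shows "vabs (x + y) = vabs y"
proof (rule antisym)
  show "vabs (x + y) \<le> vabs y"
    using vabs_add[of x y] assms by simp
  show "vabs y \<le> vabs (x + y)"
    using vabs_diff[of "x + y" x] assms by simp
qed

text \<open>The difference is \<open>a - b\<close> times a sum of products of elements of the closed
  unit ball, which is closed under sums and products.\<close>

lemma vabs_power_diff_le:
  fixes a b :: "'a::nonarch_field"
  assumes "vabs a \<le> 1" "vabs b \<le> 1"
  shows "vabs (a ^ n - b ^ n) \<le> vabs (a - b)"
proof -
  have "vabs (\<Sum>i<n. b ^ (n - Suc i) * a ^ i) \<le> 1"
    using assms by (intro vabs_sum_le) (auto simp: vabs_mult vabs_power intro!: mult_le_one power_le_one)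
  then show ?thesis
    unfolding power_diff_sumr2 vabs_mult by (simp add: mult_left_le)
qed

section \<open>Limits and continuity of the field operations\<close>

lemma tendsto_vabs_iff:
  fixes l :: "'a::nonarch_field"
  shows "(f \<longlongrightarrow> l) F \<longleftrightarrow> ((\<lambda>x. vabs (f x - l)) \<longlongrightarrow> 0) F"
  by (subst tendsto_dist_iff) (simp add: dist_vabs)

lemma tendsto_vabs_zero_iff:
  "((\<lambda>x. vabs (f x)) \<longlongrightarrow> 0) F \<longleftrightarrow> (f \<longlongrightarrow> (0 :: 'a::nonarch_field)) F"
  by (simp add: tendsto_vabs_iff[of f])

lemma tendsto_vabs_diff_Pair:
  fixes a b :: "'a::nonarch_field"
  shows "((\<lambda>z. vabs (fst z - a)) \<longlongrightarrow> 0) (nhds a \<times>\<^sub>F nhds b)"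
    and "((\<lambda>z. vabs (snd z - b)) \<longlongrightarrow> 0) (nhds a \<times>\<^sub>F nhds b)"
  unfolding nhds_prod[symmetric] tendsto_vabs_iff[symmetric]
  using tendsto_fst[OF filterlim_ident, of "(a, b)"] tendsto_snd[OF filterlim_ident, of "(a, b)"]
  by simp_all

text \<open>This instance and the next make the generic limit laws for sums and products
  available.\<close>

instance nonarch_field \<subseteq> topological_ab_group_add
proof
  fix a b :: 'a
  note lim = tendsto_vabs_diff_Pair[where a = a and b = b]
  show "((\<lambda>z. fst z + snd z) \<longlongrightarrow> a + b) (nhds a \<times>\<^sub>F nhds b)"
    unfolding tendsto_vabs_iff
  proof (rule tendsto_sandwich[OF _ _ tendsto_const])
    show "((\<lambda>z. vabs (fst z - a) + vabs (snd z - b)) \<longlongrightarrow> 0) (nhds a \<times>\<^sub>F nhds b)"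
      using tendsto_add[OF lim] by simp
    show "\<forall>\<^sub>F z in nhds a \<times>\<^sub>F nhds b. vabs (fst z + snd z - (a + b)) \<le> vabs (fst z - a) + vabs (snd z - b)"
      by (intro always_eventually allI)
         (smt (verit) add_diff_add vabs_add vabs_nonneg)
  qed simp
  show "(uminus \<longlongrightarrow> - a) (nhds a)"
    unfolding tendsto_vabs_iff
    using tendsto_vabs_iff[of "\<lambda>x. x" a "nhds a"] filterlim_ident[of "nhds a"]
    by (simp add: vabs_minus_commute)
qed

instance nonarch_field \<subseteq> topological_semigroup_mult
proof
  fix a b :: 'a
  note lim = tendsto_vabs_diff_Pair[where a = a and b = b]
  let ?B = "\<lambda>z. vabs (fst z - a) * vabs (snd z - b) + vabs a * vabs (snd z - b) + vabs (fst z - a) * vabs b"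
  show "((\<lambda>z. fst z * snd z) \<longlongrightarrow> a * b) (nhds a \<times>\<^sub>F nhds b)"
    unfolding tendsto_vabs_iff
  proof (rule tendsto_sandwich[OF _ _ tendsto_const])
    show "(?B \<longlongrightarrow> 0) (nhds a \<times>\<^sub>F nhds b)"
      by (rule tendsto_eq_intros refl lim)+ simp
    have "vabs (u * v - a * b) \<le> ?B (u, v)" for u v
    proof -
      have "vabs (u * v - a * b) = vabs ((u - a) * (v - b) + a * (v - b) + (u - a) * b)"
        by (simp add: algebra_simps)
      also have "\<dots> \<le> ?B (u, v)"
        unfolding fst_conv snd_conv vabs_mult[symmetric]
        by (smt (verit) vabs_add vabs_nonneg)
      finally show ?thesis .
    qed
    then show "\<forall>\<^sub>F z in nhds a \<times>\<^sub>F nhds b. vabs (fst z * snd z - a * b) \<le> ?B z"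
      by (intro always_eventually allI) (metis prod.collapse)
  qed simp
qed

lemma tendsto_poly_nonarch:
  fixes P :: "'a::nonarch_field poly"
  assumes "(f \<longlongrightarrow> a) F"
  shows "((\<lambda>x. poly P (f x)) \<longlongrightarrow> poly P a) F"
  by (induction P) (auto intro!: tendsto_add tendsto_mult tendsto_const assms)

text \<open>Ultrametric bounds are non-strict and pass to sums without loss, so this form spares
  splitting \<open>e\<close>.\<close>

lemma tendsto_nonarch_iff:
  fixes l :: "'a::nonarch_field"
  shows "f \<longlonglongrightarrow> l \<longleftrightarrow> (\<forall>e>0. \<exists>N. \<forall>n\<ge>N. vabs (f n - l) \<le> e)"
  unfolding LIMSEQ_def dist_vabs
  by (meson dense less_imp_le order.strict_trans1)

text \<open>Away from 0 the absolute value is locally constant: once \<open>f n\<close> is closer to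
  \<open>l\<close> than \<open>vabs l\<close>, both have the same absolute value.\<close>

lemma vabs_limit_le:
  fixes l :: "'a::nonarch_field"
  assumes "f \<longlonglongrightarrow> l" "eventually (\<lambda>n. vabs (f n) \<le> C) sequentially"
  shows "vabs l \<le> C"
proof (cases "l = 0")
  case True
  obtain n where "vabs (f n) \<le> C"
    using assms(2) unfolding eventually_sequentially by blast
  then have "0 \<le> C"
    using order_trans[OF vabs_nonneg] by blast
  then show ?thesis
    using True by simp
next
  case False
  then have "eventually (\<lambda>n. dist (f n) l < vabs l) sequentially"
    using assms(1) by (intro tendstoD) auto
  with assms(2) have "eventually (\<lambda>n. vabs (f n) \<le> C \<and> dist (f n) l < vabs l) sequentially"
    by eventually_elim auto
  then obtain n where n: "vabs (f n) \<le> C" "vabs (f n - l) < vabs l"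
    unfolding eventually_sequentially dist_vabs by blast
  show ?thesis
    using vabs_add_eq_right[OF n(2)] n(1) by simp
qed

section \<open>Convergent series, exchange of sums and dominated limits\<close>

lemma sums_mult_nonarch:
  fixes f :: "nat \<Rightarrow> 'a::nonarch_field"
  shows "f sums s \<Longrightarrow> (\<lambda>n. c * f n) sums (c * s)"
  unfolding sums_def sum_distrib_left[symmetric] by (rule tendsto_mult_left)

lemma sums_diff_nonarch:
  fixes f g :: "nat \<Rightarrow> 'a::nonarch_field"
  shows "f sums s \<Longrightarrow> g sums t \<Longrightarrow> (\<lambda>n. f n - g n) sums (s - t)"
  using sums_add[OF _ sums_mult_nonarch[of g t "- 1"]] by simp

lemma sums_imp_LIMSEQ_zero:
  fixes f :: "nat \<Rightarrow> 'a::nonarch_field"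
  assumes "f sums s"
  shows "f \<longlonglongrightarrow> 0"
proof -
  have "(\<lambda>n. sum f {..<Suc n} + - sum f {..<n}) \<longlonglongrightarrow> s + - s"
    using assms unfolding sums_def by (intro tendsto_add tendsto_minus LIMSEQ_Suc)
  then show ?thesis
    by simp
qed

lemma LIMSEQ_zero_vabs_bounded:
  fixes f :: "nat \<Rightarrow> 'a::nonarch_field"
  assumes "f \<longlonglongrightarrow> 0"
  obtains C where "0 < C" "\<And>n. vabs (f n) \<le> C"
proof -
  have "(\<lambda>n. vabs (f n)) \<longlonglongrightarrow> 0"
    using assms by (simp add: tendsto_vabs_zero_iff)
  then have "Bseq (\<lambda>n. vabs (f n))"
    by (intro convergent_imp_Bseq convergentI)
  then show ?thesis
    using that unfolding Bseq_def by auto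
qed

text \<open>The tail is a limit of finite blocks, and each block is bounded by its largest
  term.\<close>

lemma vabs_sums_tail_le:
  fixes f :: "nat \<Rightarrow> 'a::nonarch_field"
  assumes "f sums s" "\<And>i. i \<ge> n \<Longrightarrow> vabs (f i) \<le> C" "0 \<le> C"
  shows "vabs (s - sum f {..<n}) \<le> C"
proof (rule vabs_limit_le)
  show "(\<lambda>k. sum f {..<k} + - sum f {..<n}) \<longlonglongrightarrow> s - sum f {..<n}"
    using tendsto_add[OF assms(1)[unfolded sums_def] tendsto_const[of "- sum f {..<n}"]] by simp
  have "vabs (sum f {..<k} + - sum f {..<n}) \<le> C" if "k \<ge> n" for k
  proof -
    have "sum f {..<k} = sum f {..<n} + sum f {n..<k}"
      using that by (simp add: lessThan_atLeast0 sum.atLeastLessThan_concat)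
    moreover have "vabs (sum f {n..<k}) \<le> C"
      using assms(2,3) by (intro vabs_sum_le) auto
    ultimately show ?thesis
      by simp
  qed
  then show "eventually (\<lambda>k. vabs (sum f {..<k} + - sum f {..<n}) \<le> C) sequentially"
    unfolding eventually_sequentially by blast
qed

lemma vabs_sums_le:
  fixes f :: "nat \<Rightarrow> 'a::nonarch_field"
  assumes "f sums s" "\<And>i. vabs (f i) \<le> C"
  shows "vabs s \<le> C"
  using vabs_sums_tail_le[OF assms(1), of 0 C] assms(2) order_trans[OF vabs_nonneg assms(2)] by simp

text \<open>A block of terms is at most as large as its largest term, so null terms already make the
  partial sums Cauchy.\<close>

lemma summable_nonarch:
  fixes f :: "nat \<Rightarrow> 'a::nonarch_field"
  assumes "complete (UNIV :: 'a set)" "f \<longlonglongrightarrow> 0"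
  shows "summable f"
proof -
  have "Cauchy (\<lambda>n. sum f {..<n})"
    unfolding Cauchy_altdef
  proof (intro allI impI)
    fix e :: real
    assume "e > 0"
    then obtain N where N: "\<And>n. n \<ge> N \<Longrightarrow> vabs (f n) \<le> e / 2"
      using assms(2) unfolding tendsto_nonarch_iff by (metis diff_zero half_gt_zero)
    have "dist (sum f {..<m}) (sum f {..<n}) < e" if "m \<ge> N" "n > m" for m n
    proof -
      have "sum f {..<n} = sum f {..<m} + sum f {m..<n}"
        using that by (simp add: lessThan_atLeast0 sum.atLeastLessThan_concat)
      moreover have "vabs (sum f {m..<n}) \<le> e / 2"
        using N that \<open>e > 0\<close> by (intro vabs_sum_le) auto
      ultimately show ?thesis
        using \<open>e > 0\<close> by (simp add: dist_vabs)
    qed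
    then show "\<exists>M. \<forall>m\<ge>M. \<forall>n>m. dist (sum f {..<m}) (sum f {..<n}) < e"
      by blast
  qed
  then show ?thesis
    using assms(1) unfolding complete_def summable_def sums_def by blast
qed

text \<open>All entries outside an \<open>N\<close> by \<open>N\<close> square are at most
  \<open>e\<close>, so for \<open>n \<ge> N\<close> the first \<open>n\<close> row sums and the
  first \<open>n\<close> column sums both agree with the sum over the \<open>n\<close> by
  \<open>n\<close> square up to \<open>e\<close>.\<close>

lemma sums_swap:
  fixes a :: "nat \<Rightarrow> nat \<Rightarrow> 'a::nonarch_field"
  assumes small: "\<And>e. e > 0 \<Longrightarrow> \<exists>N. \<forall>i j. i \<ge> N \<or> j \<ge> N \<longrightarrow> vabs (a i j) \<le> e"
    and rows: "\<And>i. (\<lambda>j. a i j) sums r i"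
    and cols: "\<And>j. (\<lambda>i. a i j) sums c j"
    and "r sums s"
  shows "c sums s"
proof -
  have "(\<lambda>n. sum c {..<n} - sum r {..<n}) \<longlonglongrightarrow> 0"
    unfolding tendsto_nonarch_iff
  proof (intro allI impI)
    fix e :: real
    assume "e > 0"
    then obtain N where N: "\<And>i j. i \<ge> N \<or> j \<ge> N \<Longrightarrow> vabs (a i j) \<le> e"
      using small by blast
    have "vabs (sum c {..<n} - sum r {..<n}) \<le> e" if "n \<ge> N" for n
    proof -
      have "vabs (\<Sum>j<n. c j - (\<Sum>i<n. a i j)) \<le> e" "vabs (\<Sum>i<n. r i - (\<Sum>j<n. a i j)) \<le> e"
        using N that \<open>e > 0\<close>
        by (auto intro!: vabs_sum_le vabs_sums_tail_le[OF rows] vabs_sums_tail_le[OF cols])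
      moreover have "sum c {..<n} - sum r {..<n} =
          (\<Sum>j<n. c j - (\<Sum>i<n. a i j)) - (\<Sum>i<n. r i - (\<Sum>j<n. a i j))"
        using sum.swap[of a "{..<n}" "{..<n}"] by (simp add: sum_subtractf)
      ultimately show ?thesis
        by (simp only: vabs_diff_le)
    qed
    then show "\<exists>N. \<forall>n\<ge>N. vabs (sum c {..<n} - sum r {..<n} - 0) \<le> e"
      by auto
  qed
  from tendsto_add[OF this \<open>r sums s\<close>[unfolded sums_def]] show ?thesis
    by (simp add: sums_def)
qed

text \<open>Dominated convergence: cut all series at a common \<open>L\<close> beyond which
  \<open>g\<close> is at most \<open>e\<close>, and pass to the limit in the remaining finite
  sum.\<close>

lemma tendsto_sums_dominated:
  fixes c :: "nat \<Rightarrow> nat \<Rightarrow> 'a::nonarch_field"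
  assumes sums: "\<And>N. c N sums s N" "d sums t"
    and bound: "\<And>N l. vabs (c N l) \<le> g l" and "g \<longlonglongrightarrow> 0"
    and lim: "\<And>l. (\<lambda>N. c N l) \<longlonglongrightarrow> d l"
  shows "s \<longlonglongrightarrow> t"
  unfolding tendsto_nonarch_iff
proof (intro allI impI)
  fix e :: real
  assume "e > 0"
  have bound_d: "vabs (d l) \<le> g l" for l
    by (rule vabs_limit_le[OF lim]) (simp add: bound)
  obtain L where L: "\<And>l. l \<ge> L \<Longrightarrow> g l \<le> e"
    using \<open>g \<longlonglongrightarrow> 0\<close> \<open>e > 0\<close> unfolding LIMSEQ_def by (fastforce simp: dist_real_def)
  have "(\<lambda>N. sum (c N) {..<L}) \<longlonglongrightarrow> sum d {..<L}"
    by (intro tendsto_sum lim)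
  then obtain M where M: "\<And>N. N \<ge> M \<Longrightarrow> vabs (sum (c N) {..<L} - sum d {..<L}) \<le> e"
    using \<open>e > 0\<close> unfolding tendsto_nonarch_iff by blast
  have "vabs (s N - t) \<le> e" if "N \<ge> M" for N
  proof -
    have "s N - t = (s N - sum (c N) {..<L}) + (sum (c N) {..<L} - sum d {..<L}) - (t - sum d {..<L})"
      by simp
    moreover have "vabs (s N - sum (c N) {..<L}) \<le> e" "vabs (t - sum d {..<L}) \<le> e"
      using order_trans[OF bound L] order_trans[OF bound_d L] \<open>e > 0\<close>
      by (auto intro!: vabs_sums_tail_le[OF sums(1)] vabs_sums_tail_le[OF sums(2)])
    ultimately show ?thesis
      using M[OF that] by (simp only: vabs_add_le vabs_diff_le)
  qed
  then show "\<exists>M. \<forall>N\<ge>M. vabs (s N - t) \<le> e"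
    by blast
qed

text \<open>Put \<open>f i * g (n - i)\<close> into row \<open>i\<close> and column \<open>n\<close>
  of a triangular array. Rows sum to \<open>f i * t\<close>, columns to the convolution, and
  \<open>sums_swap\<close> exchanges them.\<close>

lemma Cauchy_product_sums_nonarch:
  fixes f g :: "nat \<Rightarrow> 'a::nonarch_field"
  assumes "f sums s" "g sums t"
  shows "(\<lambda>n. \<Sum>k\<le>n. f k * g (n - k)) sums (s * t)"
proof (rule sums_swap)
  let ?a = "\<lambda>i n. if i \<le> n then f i * g (n - i) else 0"
  have f0: "f \<longlonglongrightarrow> 0" and g0: "g \<longlonglongrightarrow> 0"
    using assms sums_imp_LIMSEQ_zero by auto
  obtain F where F: "0 < F" "\<And>n. vabs (f n) \<le> F"
    using LIMSEQ_zero_vabs_bounded[OF f0] by blast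
  obtain G where G: "0 < G" "\<And>n. vabs (g n) \<le> G"
    using LIMSEQ_zero_vabs_bounded[OF g0] by blast
  show "\<exists>N. \<forall>i j. i \<ge> N \<or> j \<ge> N \<longrightarrow> vabs (?a i j) \<le> e" if "e > 0" for e
  proof -
    obtain N1 where N1: "\<And>n. n \<ge> N1 \<Longrightarrow> vabs (f n) \<le> e / G"
      using f0 \<open>e > 0\<close> G(1) unfolding tendsto_nonarch_iff by (metis diff_zero divide_pos_pos)
    obtain N2 where N2: "\<And>n. n \<ge> N2 \<Longrightarrow> vabs (g n) \<le> e / F"
      using g0 \<open>e > 0\<close> F(1) unfolding tendsto_nonarch_iff by (metis diff_zero divide_pos_pos)
    have "vabs (?a i j) \<le> e" if "i \<ge> N1 + N2 \<or> j \<ge> N1 + N2" for i j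
    proof (cases "i \<le> j")
      case True
      \<comment> \<open>Here \<open>j \<ge> N1 + N2\<close> in either case, and \<open>i\<close> and
        \<open>j - i\<close> add up to \<open>j\<close>; one factor is then small and the other
        bounded.\<close>
      then have "i \<ge> N1 \<or> j - i \<ge> N2"
        using that by linarith
      then show ?thesis
      proof
        assume 1: "i \<ge> N1"
        have "vabs (f i) * vabs (g (j - i)) \<le> e / G * G"
          using N1[OF 1] G \<open>e > 0\<close> by (intro mult_mono) auto
        then show ?thesis
          using G(1) True by (simp add: vabs_mult)
      next
        assume 2: "j - i \<ge> N2"
        have "vabs (f i) * vabs (g (j - i)) \<le> F * (e / F)"
          using N2[OF 2] F \<open>e > 0\<close> by (intro mult_mono) auto
        then show ?thesis
          using F(1) True by (simp add: vabs_mult)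
      qed
    qed (use \<open>e > 0\<close> in simp)
    then show ?thesis
      by blast
  qed
  show "?a i sums (f i * t)" for i
  proof -
    \<comment> \<open>Row \<open>i\<close> starts only at column \<open>i\<close>, so its first
      \<open>N + i\<close> entries hold exactly \<open>N\<close> terms of \<open>g\<close>.\<close>
    have "(\<lambda>N. \<Sum>n<N + i. ?a i n) \<longlonglongrightarrow> f i * t"
    proof -
      have "(\<Sum>n<N + i. ?a i n) = (\<Sum>n<N. f i * g n)" for N
      proof -
        have "(\<Sum>n<N + i. ?a i n) = (\<Sum>n\<in>{i..<N + i}. f i * g (n - i))"
          by (rule sum.mono_neutral_cong_right) auto
        also have "\<dots> = (\<Sum>n<N. f i * g n)"
          by (rule sum.reindex_bij_witness[of _ "\<lambda>n. n + i" "\<lambda>n. n - i"]) auto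
        finally show ?thesis .
      qed
      then show ?thesis
        using sums_mult_nonarch[OF assms(2), of "f i"] by (simp add: sums_def)
    qed
    then show ?thesis
      unfolding sums_def by (rule LIMSEQ_offset)
  qed
  show "(\<lambda>i. ?a i n) sums (\<Sum>k\<le>n. f k * g (n - k))" for n
    using sums_If_finite_set[of "{..n}" "\<lambda>i. f i * g (n - i)"] by simp
  show "(\<lambda>i. f i * t) sums (s * t)"
    using sums_mult_nonarch[OF assms(1), of t] by (simp add: mult.commute)
qed

section \<open>Factorials and Stirling numbers\<close>

text \<open>One step of Legendre's formula: only the \<open>k div p\<close> multiples of
  \<open>p\<close> contribute, and dividing each by \<open>p\<close> leaves
  \<open>fact (k div p)\<close>.\<close>

lemma multiplicity_fact_div:
  fixes p k :: nat
  assumes "prime p"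
  shows "multiplicity p (fact k :: nat) = k div p + multiplicity p (fact (k div p) :: nat)"
proof (induction k)
  case 0
  then show ?case by simp
next
  case (Suc k)
  have p: "prime_elem p" "p > 1"
    using assms prime_gt_1_nat by auto
  have *: "multiplicity p (fact (Suc j) :: nat) = multiplicity p (Suc j) + multiplicity p (fact j :: nat)" for j
    using prime_elem_multiplicity_mult_distrib[OF p(1), of "Suc j" "fact j"] by simp
  show ?case
  proof (cases "p dvd Suc k")
    case False
    then have "multiplicity p (Suc k) = 0" "Suc k div p = k div p"
      by (auto simp: not_dvd_imp_multiplicity_0 div_Suc dvd_eq_mod_eq_0)
    then show ?thesis
      using * Suc.IH by simp
  next
    case True
    then have div: "Suc k div p = Suc (k div p)"
      by (auto simp: div_Suc dvd_eq_mod_eq_0)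
    then have "Suc k = p * Suc (k div p)"
      using True by (metis dvd_mult_div_cancel)
    moreover have "multiplicity p (p * Suc (k div p)) = Suc (multiplicity p (Suc (k div p)))"
      using p by (intro multiplicity_times_same) auto
    ultimately have "multiplicity p (Suc k) = Suc (multiplicity p (Suc (k div p)))"
      by simp
    then show ?thesis
      unfolding div * using Suc.IH by simp
  qed
qed

text \<open>Induction along Legendre's recursion, closing with \<open>p * (k div p) \<le> k\<close>.
  The strictness produces the exponent \<open>k - 1\<close> in \<open>vabs_fact_ge\<close>.\<close>

lemma multiplicity_fact_less:
  fixes p k :: nat
  assumes "prime p" "k > 0"
  shows "(p - 1) * multiplicity p (fact k :: nat) < k"
  using assms(2)
proof (induction k rule: less_induct)
  case (less k)
  have p: "p > 1"
    using assms(1) prime_gt_1_nat by blast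
  show ?case
  proof (cases "k div p = 0")
    case True
    then show ?thesis
      using multiplicity_fact_div[OF assms(1), of k] less.prems by simp
  next
    case False
    then have "(p - 1) * multiplicity p (fact (k div p) :: nat) < k div p"
      using less.IH[of "k div p"] less.prems p by simp
    then have "(p - 1) * multiplicity p (fact k :: nat) < (p - 1) * (k div p) + k div p"
      using multiplicity_fact_div[OF assms(1), of k] by (simp add: distrib_left)
    also have "\<dots> = p * (k div p)"
      using p by (simp add: algebra_simps)
    also have "\<dots> \<le> k"
      by simp
    finally show ?thesis .
  qed
qed

section \<open>Stirling numbers and powers of the formal logarithm\<close>

lemma signed_stirling1_0: "signed_stirling1 0 l = (if l = 0 then 1 else 0)"
  by (simp add: signed_stirling1_def one_pCons coeff_pCons split: nat.split)

lemma signed_stirling1_Suc: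
  "signed_stirling1 (Suc n) l =
     (if l = 0 then 0 else signed_stirling1 n (l - 1)) - int n * signed_stirling1 n l"
  by (simp add: signed_stirling1_def coeff_pCons split: nat.split)

lemma signed_stirling1_eq_0: "n < l \<Longrightarrow> signed_stirling1 n l = 0"
  by (induction n arbitrary: l) (auto simp: signed_stirling1_0 signed_stirling1_Suc)

lemma signed_stirling1_0_right: "signed_stirling1 n 0 = (if n = 0 then 1 else 0)"
  by (induction n) (auto simp: signed_stirling1_0 signed_stirling1_Suc)

text \<open>Evaluate the falling factorial at 1: from \<open>n = 2\<close> on, the factor for
  \<open>j = 1\<close> vanishes.\<close>

lemma sum_signed_stirling1:
  "(\<Sum>l\<le>n. signed_stirling1 n l) = (if n \<le> 1 then 1 else 0)"
proof -
  let ?P = "\<Prod>j<n. [:- int j, 1:]"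
  have "(\<Sum>l\<le>n. signed_stirling1 n l) = poly ?P 1"
  proof -
    have "degree ?P = n"
      by (subst degree_prod_eq_sum_degree) auto
    then show ?thesis
      by (simp add: poly_altdef signed_stirling1_def)
  qed
  also have "\<dots> = (\<Prod>j<n. 1 - int j)"
    by (simp add: poly_prod)
  also have "\<dots> = (if n \<le> 1 then 1 else 0)"
  proof (cases "n \<le> 1")
    case True
    then show ?thesis
      by (cases n) auto
  next
    case False
    then have "(\<Prod>j<n. 1 - int j) = 0"
      by (intro prod_zero) (auto intro: bexI[of _ 1])
    then show ?thesis
      using False by simp
  qed
  finally show ?thesis .
qed

text \<open>Induction on \<open>l\<close>: with \<open>D\<close> the derivative, both
  \<open>log(1+X)^l / l!\<close> and the series \<open>F l\<close> satisfy
  \<open>(1 + X) D y_(l+1) = y_l\<close>, and they agree at 0.\<close>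

lemma fps_ln_power_nth:
  "((fps_ln 1 :: 'a::field_char_0 fps) ^ l) $ n = fact l * of_int (signed_stirling1 n l) / fact n"
proof -
  \<comment> \<open>The exponential generating function of column \<open>l\<close>; the Stirling
    recurrence becomes its differential equation.\<close>
  define F :: "nat \<Rightarrow> 'a fps" where "F l = Abs_fps (\<lambda>n. of_int (signed_stirling1 n l) / fact n)" for l
  have F_deriv: "(1 + fps_X) * fps_deriv (F (Suc l)) = F l" for l
  proof (rule fps_ext)
    fix n
    have "((1 + fps_X) * fps_deriv (F (Suc l))) $ n =
        of_nat (Suc n) * F (Suc l) $ Suc n + of_nat n * F (Suc l) $ n"
      by (cases n) (simp_all add: distrib_right)
    also have "\<dots> = F l $ n"
      by (simp add: F_def signed_stirling1_Suc field_simps del: of_nat_Suc)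
    finally show "((1 + fps_X) * fps_deriv (F (Suc l))) $ n = F l $ n" .
  qed
  have X: "(1 + fps_X :: 'a fps) \<noteq> 0"
    by (auto simp: fps_eq_iff intro!: exI[of _ 0])
  have ln_deriv: "(1 + fps_X) * fps_deriv (fps_ln 1 :: 'a fps) = 1"
    by (simp add: fps_ln_deriv inverse_mult_eq_1')
  have "(fps_ln 1 :: 'a fps) ^ l = fps_const (fact l) * F l"
  proof (induction l)
    case 0
    show ?case
      by (rule fps_ext) (simp add: F_def signed_stirling1_0_right)
  next
    case (Suc l)
    have "(1 + fps_X) * fps_deriv ((fps_ln 1 :: 'a fps) ^ Suc l) =
        of_nat (Suc l) * fps_ln 1 ^ l * ((1 + fps_X) * fps_deriv (fps_ln 1))"
      by (simp add: fps_deriv_power fps_of_nat algebra_simps del: power_Suc of_nat_Suc fps_deriv_mult)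
    also have "\<dots> = fps_const (fact (Suc l)) * F l"
      unfolding ln_deriv Suc.IH by (simp add: fps_of_nat[symmetric] mult.assoc[symmetric])
    also have "\<dots> = (1 + fps_X) * fps_deriv (fps_const (fact (Suc l)) * F (Suc l))"
      by (subst F_deriv[of l, symmetric]) (simp add: algebra_simps)
    finally have "fps_deriv ((fps_ln 1 :: 'a fps) ^ Suc l) = fps_deriv (fps_const (fact (Suc l)) * F (Suc l))"
      using X by simp
    \<comment> \<open>Equal derivatives leave only the constant terms, and both are 0.\<close>
    then show ?case
      by (subst (asm) fps_deriv_eq_iff) (simp add: F_def signed_stirling1_0)
  qed
  then show ?thesis
    by (simp add: F_def)
qed

section \<open>The p-adic exponential and logarithm\<close>

locale padic_field =
  fixes p :: nat and T :: "'a::nonarch_field itself"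
  assumes prime_p: "prime p"
    and vabs_of_nat: "k > 0 \<Longrightarrow> vabs (of_nat k :: 'a) = 1 / real p ^ multiplicity p k"
    and complete_UNIV: "complete (UNIV :: 'a set)"
begin

section \<open>The radius of convergence and the size of factorials\<close>

abbreviation r :: real where "r \<equiv> conv_radius_exp p"

lemma p_gt_1: "p > 1"
  using prime_p prime_gt_1_nat by blast

lemma r_pos: "0 < r"
  using p_gt_1 by (simp add: conv_radius_exp_def)

lemma r_less_1: "r < 1"
  using p_gt_1 powr_less_one[of "real p" "- 1 / (real p - 1)"]
  by (simp add: conv_radius_exp_def)

lemma r_power: "r ^ (p - 1) = 1 / real p"
proof -
  have "r ^ (p - 1) = real p powr (real (p - 1) * (- 1 / (real p - 1)))"
    unfolding conv_radius_exp_def using p_gt_1 by (subst powr_power) (auto simp: mult.commute)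
  also have "real (p - 1) * (- 1 / (real p - 1)) = - 1"
    using p_gt_1 by (simp add: of_nat_diff)
  finally show ?thesis
    using p_gt_1 by (simp add: powr_minus_divide)
qed

lemma vabs_p_power: "vabs (of_nat (p ^ N) :: 'a) = 1 / real p ^ N"
  using vabs_of_nat[of "p ^ N"] p_gt_1 prime_p
  by (simp add: prime_elem_multiplicity_power_distrib del: of_nat_power)

lemma p_power_tendsto_0: "(\<lambda>N. of_nat (p ^ N) :: 'a) \<longlonglongrightarrow> 0"
proof -
  have "(\<lambda>N. inverse (real p ^ N)) \<longlonglongrightarrow> 0"
    using p_gt_1 by (intro LIMSEQ_inverse_realpow_zero) simp
  then show ?thesis
    unfolding tendsto_vabs_zero_iff[symmetric] vabs_p_power by (simp add: divide_inverse)
qed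

text \<open>By \<open>r_power\<close>, the size of \<open>fact k\<close> is a power of
  \<open>r\<close> whose exponent is at most \<open>k - 1\<close> by
  \<open>multiplicity_fact_less\<close>.\<close>

lemma vabs_fact_ge:
  assumes "k > 0"
  shows "r ^ (k - 1) \<le> vabs (fact k :: 'a)"
proof -
  have "vabs (fact k :: 'a) = (1 / real p) ^ multiplicity p (fact k :: nat)"
    using vabs_of_nat[of "fact k"] by (simp add: power_one_over)
  also have "\<dots> = r ^ ((p - 1) * multiplicity p (fact k :: nat))"
    by (simp only: r_power power_mult)
  also have "\<dots> \<ge> r ^ (k - 1)"
    using multiplicity_fact_less[OF prime_p assms] r_pos r_less_1
    by (intro power_decreasing) auto
  finally show ?thesis .
qed

text \<open>Besides geometric decay with ratio \<open>c / r\<close>, the bound keeps one factor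
  \<open>c\<close>, which yields estimates relative to the argument itself.\<close>

lemma power_over_fact_le:
  assumes "0 \<le> c" "k > 0"
  shows "c ^ k / vabs (fact k :: 'a) \<le> c * (c / r) ^ (k - 1)"
proof -
  have "c ^ k / vabs (fact k :: 'a) \<le> c ^ k / r ^ (k - 1)"
    using vabs_fact_ge[OF assms(2)] r_pos assms(1) by (intro divide_left_mono) auto
  also have "\<dots> = c * (c / r) ^ (k - 1)"
    using assms(2) by (cases k) (simp_all add: power_divide)
  finally show ?thesis .
qed

lemma power_over_fact_tendsto_0:
  assumes "0 \<le> c" "c < r"
  shows "(\<lambda>k. c ^ k / vabs (fact k :: 'a)) \<longlonglongrightarrow> 0"
proof -
  have "(\<lambda>k. c * (c / r) ^ k) \<longlonglongrightarrow> c * 0"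
    using assms r_pos by (intro tendsto_mult tendsto_const LIMSEQ_realpow_zero) auto
  then have lim: "(\<lambda>k. c * (c / r) ^ k) \<longlonglongrightarrow> 0"
    by simp
  have "(\<lambda>k. c ^ Suc k / vabs (fact (Suc k) :: 'a)) \<longlonglongrightarrow> 0"
  proof (rule tendsto_sandwich[OF _ _ tendsto_const lim])
    show "\<forall>\<^sub>F k in sequentially. c ^ Suc k / vabs (fact (Suc k) :: 'a) \<le> c * (c / r) ^ k"
      using power_over_fact_le[OF assms(1), of "Suc k" for k] by simp
  qed (use assms in \<open>simp del: fact_Suc\<close>)
  then show ?thesis
    by (rule LIMSEQ_imp_Suc)
qed

section \<open>The exponential\<close>

lemma vabs_exp_term_le:
  assumes "vabs z < r" "0 < n" "n \<le> k"
  shows "vabs (z ^ k / fact k :: 'a) \<le> vabs z * (vabs z / r) ^ (n - 1)"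
proof -
  have "vabs (z ^ k / fact k :: 'a) \<le> vabs z * (vabs z / r) ^ (k - 1)"
    using power_over_fact_le[of "vabs z" k] assms by (simp add: vabs_divide vabs_power)
  also have "\<dots> \<le> vabs z * (vabs z / r) ^ (n - 1)"
    using assms r_pos by (intro mult_left_mono power_decreasing) auto
  finally show ?thesis .
qed

lemma exp_term_tendsto_0:
  assumes "vabs z < r"
  shows "(\<lambda>k. z ^ k / fact k :: 'a) \<longlonglongrightarrow> 0"
  using power_over_fact_tendsto_0[of "vabs z"] assms
  by (subst tendsto_vabs_zero_iff[symmetric]) (simp add: vabs_divide vabs_power)

lemma padic_exp_sums:
  assumes "vabs (z :: 'a) < r"
  shows "(\<lambda>k. z ^ k / fact k) sums padic_exp z"
  unfolding padic_exp_def
  by (intro summable_sums summable_nonarch complete_UNIV exp_term_tendsto_0 assms)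

text \<open>For nonzero \<open>z\<close> the linear term strictly dominates all later ones, as
  \<open>vabs z / r < 1\<close>; the isosceles principle applies.\<close>

lemma vabs_padic_exp_minus_1:
  assumes "vabs (z :: 'a) < r"
  shows "vabs (padic_exp z - 1) = vabs z"
proof -
  have "vabs (padic_exp z - sum (\<lambda>k. z ^ k / fact k) {..<2}) \<le> vabs z * (vabs z / r)"
    using vabs_exp_term_le[OF assms, of 2] r_pos
    by (intro vabs_sums_tail_le[OF padic_exp_sums[OF assms]]) auto
  then have *: "vabs (padic_exp z - 1 - z) \<le> vabs z * (vabs z / r)"
    by (simp add: numeral_2_eq_2 algebra_simps)
  show ?thesis
  proof (cases "z = 0")
    case True
    then show ?thesis
      using * order_antisym[OF _ vabs_nonneg[of "padic_exp z - 1"]] by simp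
  next
    case False
    then have "vabs z * (vabs z / r) < vabs z * 1"
      using assms r_pos by (intro mult_strict_left_mono) auto
    then show ?thesis
      using vabs_add_eq_right[of "padic_exp z - 1 - z" z] * by simp
  qed
qed

lemma padic_exp_0: "padic_exp (0 :: 'a) = 1"
  using vabs_padic_exp_minus_1[of 0] r_pos by simp

lemma vabs_padic_exp:
  assumes "vabs (z :: 'a) < r"
  shows "vabs (padic_exp z) = 1"
  using vabs_add_eq_right[of "padic_exp z - 1" 1] vabs_padic_exp_minus_1[OF assms] assms r_less_1
  by simp

lemma padic_exp_add:
  assumes "vabs (x :: 'a) < r" "vabs y < r"
  shows "padic_exp (x + y) = padic_exp x * padic_exp y"
proof -
  have "vabs (x + y) < r"
    using vabs_add[of x y] assms by simp
  then have "(\<lambda>n. (x + y) ^ n / fact n) sums padic_exp (x + y)"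
    by (rule padic_exp_sums)
  moreover have "(\<lambda>n. \<Sum>k\<le>n. (x ^ k / fact k) * (y ^ (n - k) / fact (n - k))) sums (padic_exp x * padic_exp y)"
    by (intro Cauchy_product_sums_nonarch padic_exp_sums assms)
  moreover have "(\<Sum>k\<le>n. (x ^ k / fact k) * (y ^ (n - k) / fact (n - k))) = (x + y) ^ n / fact n" for n
    by (simp add: binomial_ring sum_divide_distrib binomial_fact field_simps)
  ultimately show ?thesis
    using sums_unique2 by simp
qed

lemma padic_exp_of_nat_mult:
  assumes "vabs (z :: 'a) < r"
  shows "padic_exp (of_nat n * z) = padic_exp z ^ n"
proof (induction n)
  case (Suc n)
  have "vabs (of_nat n * z) < r"
    using assms by (simp add: vabs_mult) (meson le_less_trans mult_left_le_one_le vabs_nonneg vabs_of_nat_le_1)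
  then show ?case
    using padic_exp_add[OF assms, of "of_nat n * z"] Suc by (simp add: distrib_right)
qed (simp add: padic_exp_0)

text \<open>Cancelling the nonzero factor \<open>padic_exp y\<close> gives
  \<open>padic_exp (x - y) = 1\<close>, and \<open>vabs (x - y)\<close> is the distance of this
  value from 1.\<close>

lemma padic_exp_inject:
  assumes "vabs (x :: 'a) < r" "vabs y < r" "padic_exp x = padic_exp y"
  shows "x = y"
proof -
  have xy: "vabs (x - y) < r"
    using vabs_diff[of x y] assms by simp
  have "padic_exp (x - y) * padic_exp y = padic_exp y"
    using padic_exp_add[OF xy assms(2)] assms(3) by simp
  moreover have "padic_exp y \<noteq> 0"
    using vabs_padic_exp[OF assms(2)] by auto
  ultimately show ?thesis
    using vabs_padic_exp_minus_1[OF xy] by simp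
qed

section \<open>The logarithm as inverse of the exponential\<close>

text \<open>\<open>fact n\<close> is \<open>n\<close> times an integer, hence no larger than
  \<open>n\<close>. The estimates for exponential terms thus carry over to logarithmic ones.\<close>

lemma vabs_log_term_le: "vabs (fps_ln 1 $ n * w ^ n) \<le> vabs (w ^ n / fact n :: 'a)"
proof (cases n)
  case (Suc k)
  have "vabs (fact n :: 'a) = vabs (of_nat n :: 'a) * vabs (fact k :: 'a)"
    using Suc by (simp add: vabs_mult)
  also have "\<dots> \<le> vabs (of_nat n :: 'a)"
    using vabs_of_nat_le_1[of "fact k", where 'a = 'a] by (simp add: mult_left_le)
  finally have "vabs w ^ n / vabs (of_nat n :: 'a) \<le> vabs w ^ n / vabs (fact n :: 'a)"
    by (intro divide_left_mono) (use Suc in \<open>auto simp del: fact_Suc of_nat_Suc\<close>)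
  then show ?thesis
    using Suc by (simp add: fps_ln_nth vabs_divide vabs_mult vabs_power del: fact_Suc of_nat_Suc)
qed simp

lemma padic_log_sums:
  assumes "vabs (w :: 'a) < r"
  shows "(\<lambda>n. fps_ln 1 $ n * w ^ n) sums padic_log (1 + w)"
proof -
  let ?g = "\<lambda>n. fps_ln 1 $ n * w ^ n"
  have "(\<lambda>n. vabs (?g n)) \<longlonglongrightarrow> 0"
  proof (rule tendsto_sandwich[OF _ _ tendsto_const])
    show "(\<lambda>n. vabs (w ^ n / fact n)) \<longlonglongrightarrow> 0"
      using exp_term_tendsto_0[OF assms] by (simp only: tendsto_vabs_zero_iff)
  qed (use vabs_log_term_le in simp_all)
  then have "?g \<longlonglongrightarrow> 0"
    by (simp only: tendsto_vabs_zero_iff)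
  then have sums: "?g sums suminf ?g"
    by (intro summable_sums summable_nonarch complete_UNIV)
  \<comment> \<open>\<open>padic_log\<close> is indexed from degree 1, \<open>fps_ln\<close> from
    degree 0 with a zero constant term.\<close>
  have "(\<lambda>n. sum ?g {..<Suc n}) \<longlonglongrightarrow> suminf ?g"
    using sums unfolding sums_def by (rule LIMSEQ_Suc)
  then have "(\<lambda>n. ?g (Suc n)) sums suminf ?g"
    by (simp add: sums_def sum.lessThan_Suc_shift del: sum.lessThan_Suc)
  then have "padic_log (1 + w) = suminf ?g"
    unfolding padic_log_def by (subst sums_unique) (simp_all add: fps_ln_nth)
  then show ?thesis
    using sums by simp
qed

lemma padic_log_power_sums:
  assumes "vabs (w :: 'a) < r"
  shows "(\<lambda>n. (fps_ln 1 ^ l) $ n * w ^ n) sums padic_log (1 + w) ^ l"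
proof (induction l)
  case 0
  show ?case
    using sums_single[of 0 "\<lambda>n. w ^ n"] by (simp add: if_distrib[of "\<lambda>x. x * _"] cong: if_cong)
next
  case (Suc l)
  have "(\<lambda>n. \<Sum>k\<le>n. (fps_ln 1 $ k * w ^ k) * ((fps_ln 1 ^ l) $ (n - k) * w ^ (n - k))) sums
      (padic_log (1 + w) * padic_log (1 + w) ^ l)"
    by (intro Cauchy_product_sums_nonarch padic_log_sums assms Suc)
  moreover have "(\<Sum>k\<le>n. (fps_ln 1 $ k * w ^ k) * ((fps_ln 1 ^ l) $ (n - k) * w ^ (n - k))) =
      (fps_ln 1 ^ Suc l) $ n * w ^ n" for n
    unfolding power_Suc fps_mult_nth sum_distrib_right atLeast0AtMost
    by (rule sum.cong) (simp_all add: power_add[symmetric] algebra_simps)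
  ultimately show ?case
    by simp
qed

lemma vabs_padic_log_le:
  assumes "vabs (w :: 'a) < r"
  shows "vabs (padic_log (1 + w)) \<le> vabs w"
proof (rule vabs_sums_le[OF padic_log_sums[OF assms]])
  fix n
  show "vabs (fps_ln 1 $ n * w ^ n) \<le> vabs w"
  proof (cases "n = 0")
    case False
    then show ?thesis
      using vabs_log_term_le[of n w] vabs_exp_term_le[OF assms, of 1 n] by simp
  qed simp
qed

text \<open>Expand each power of the logarithm into its Stirling series and exchange the sums.
  Stirling numbers are integers, so of absolute value at most 1, and vanish for
  \<open>l > n\<close>; thus \<open>bound\<close> makes the double array uniformly small.\<close>

lemma stirling_transform_sums:
  assumes w: "vabs (w :: 'a) < r"
    and bound: "\<And>l n. l \<le> n \<Longrightarrow> vabs (c l * w ^ n / fact n) \<le> g n" and g: "g \<longlonglongrightarrow> 0"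
    and sums: "(\<lambda>l. c l * (padic_log (1 + w) ^ l / fact l)) sums s"
  shows "(\<lambda>n. (\<Sum>l\<le>n. of_int (signed_stirling1 n l) * c l) * (w ^ n / fact n)) sums s"
proof (rule sums_swap[OF _ _ _ sums])
  let ?a = "\<lambda>l n. of_int (signed_stirling1 n l) * c l * (w ^ n / fact n)"
  show "\<exists>N. \<forall>l n. l \<ge> N \<or> n \<ge> N \<longrightarrow> vabs (?a l n) \<le> e" if "e > 0" for e
  proof -
    obtain N where N: "\<And>n. n \<ge> N \<Longrightarrow> g n \<le> e"
      using g \<open>e > 0\<close> unfolding LIMSEQ_def by (fastforce simp: dist_real_def)
    have "vabs (?a l n) \<le> e" if "l \<ge> N \<or> n \<ge> N" for l n
    proof (cases "l \<le> n")
      case True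
      have "vabs (?a l n) = vabs (of_int (signed_stirling1 n l) :: 'a) * vabs (c l * w ^ n / fact n)"
        by (simp only: vabs_mult[symmetric] times_divide_eq_right mult.assoc)
      also have "\<dots> \<le> vabs (c l * w ^ n / fact n)"
        by (intro mult_left_le_one_le) auto
      also have "\<dots> \<le> g n"
        by (rule bound) fact
      also have "\<dots> \<le> e"
        using True that by (intro N) auto
      finally show ?thesis .
    qed (use \<open>e > 0\<close> signed_stirling1_eq_0 in auto)
    then show ?thesis
      by blast
  qed
  show "(\<lambda>n. ?a l n) sums (c l * (padic_log (1 + w) ^ l / fact l))" for l
    using sums_mult_nonarch[OF padic_log_power_sums[OF w, of l], of "c l / fact l"]
    by (simp add: fps_ln_power_nth mult_ac)
  show "(\<lambda>l. ?a l n) sums ((\<Sum>l\<le>n. of_int (signed_stirling1 n l) * c l) * (w ^ n / fact n))" for n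
    unfolding sum_distrib_right
    by (rule sums_finite) (auto simp: signed_stirling1_eq_0)
qed

text \<open>The transform with all \<open>c l = 1\<close>: the coefficients become row sums of
  Stirling numbers, which leave only \<open>1 + w\<close>.\<close>

lemma padic_exp_log:
  assumes "vabs (w :: 'a) < r"
  shows "padic_exp (padic_log (1 + w)) = 1 + w"
proof -
  have "vabs (padic_log (1 + w)) < r"
    using vabs_padic_log_le[OF assms] assms by simp
  then have "(\<lambda>l. 1 * (padic_log (1 + w) ^ l / fact l)) sums padic_exp (padic_log (1 + w))"
    using padic_exp_sums by simp
  then have "(\<lambda>n. (\<Sum>l\<le>n. of_int (signed_stirling1 n l) * 1) * (w ^ n / fact n)) sums
      padic_exp (padic_log (1 + w))"
    using power_over_fact_tendsto_0[of "vabs w"] assms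
    by (intro stirling_transform_sums[where g = "\<lambda>n. vabs w ^ n / vabs (fact n :: 'a)"])
       (auto simp: vabs_divide vabs_power)
  moreover have "(\<Sum>l\<le>n. of_int (signed_stirling1 n l) * 1 :: 'a) = (if n \<le> 1 then 1 else 0)" for n
    using sum_signed_stirling1[of n] by (simp flip: of_int_sum)
  ultimately have "(\<lambda>n. (if n \<le> 1 then 1 else 0) * (w ^ n / fact n)) sums padic_exp (padic_log (1 + w))"
    by simp
  moreover have "(\<lambda>n. (if n \<le> 1 then 1 else 0) * (w ^ n / fact n)) sums
      (\<Sum>n\<in>{0, 1}. (if n \<le> 1 then 1 else 0) * (w ^ n / fact n))"
    by (rule sums_finite) auto
  ultimately show ?thesis
    using sums_unique2 by fastforce
qed

lemma vabs_padic_log: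
  assumes "vabs (w :: 'a) < r"
  shows "vabs (padic_log (1 + w)) = vabs w"
proof -
  have "vabs (padic_log (1 + w)) < r"
    using vabs_padic_log_le[OF assms] assms by simp
  then show ?thesis
    using vabs_padic_exp_minus_1 padic_exp_log[OF assms] by fastforce
qed

end

section \<open>Carlitz q-Bernoulli polynomials\<close>

text \<open>\<open>[n]\<close> in division-free form, so that \<open>q = 1\<close> needs no separate
  treatment.\<close>

definition q_int :: "'a::comm_ring_1 \<Rightarrow> nat \<Rightarrow> 'a" where
  "q_int q n = (\<Sum>j<n. q ^ j)"

lemma q_int_0 [simp]: "q_int q 0 = 0"
  by (simp add: q_int_def)

lemma q_int_1 [simp]: "q_int q (Suc 0) = 1"
  by (simp add: q_int_def)

lemma q_int_base_1 [simp]: "q_int 1 n = of_nat n"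
  by (simp add: q_int_def)

lemma q_int_Suc: "q_int q (Suc n) = 1 + q * q_int q n"
  by (simp add: q_int_def sum.lessThan_Suc_shift sum_distrib_left del: sum.lessThan_Suc)

lemma power_eq_q_int: "q ^ n = 1 + (q - 1) * q_int q n"
  using power_diff_1_eq[of q n] by (simp add: q_int_def algebra_simps)

lemma q_int_add: "q_int q (m + n) = q_int q m + q ^ m * q_int q n"
  by (induction m) (simp_all add: q_int_Suc algebra_simps)

lemma q_int_mult: "q_int q (m * n) = q_int q m * q_int (q ^ m) n"
  by (induction n) (simp_all add: q_int_Suc q_int_add algebra_simps)

text \<open>Gives the leading coefficient of the telescoping polynomial below. The offset
  \<open>j\<close> includes the vanishing above degree \<open>k\<close>, which the induction
  uses.\<close>

lemma coeff_linear_power_top: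
  "coeff ([:1, q:] ^ k) (k + j) = (if j = 0 then q ^ k else (0 :: 'a::comm_ring_1))"
proof (induction k arbitrary: j)
  case (Suc k)
  have "coeff ([:1, q:] ^ Suc k) (Suc k + j) =
      coeff ([:1, q:] ^ k) (k + Suc j) + q * coeff ([:1, q:] ^ k) (k + j)"
    by simp
  then show ?case
    unfolding Suc by simp
qed (simp add: one_pCons coeff_pCons split: nat.split)

text \<open>
  Since \<open>[y + 1] = 1 + q [y]\<close> and
  \<open>[y + 1] - [y] = q\<^sup>y\<close>, telescoping \<open>[y + 1]\<^sup>n\<^sup>+\<^sup>1 - [y]\<^sup>n\<^sup>+\<^sup>1\<close> sums \<open>q\<^sup>y R([y])\<close> for a polynomial
  \<open>R\<close> of degree \<open>n\<close> with leading coefficient \<open>[n + 1]\<close>.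
\<close>

lemma q_sum_polynomial:
  fixes q :: "'a::field" and P :: "'a poly"
  assumes "\<And>n. n > 0 \<Longrightarrow> q_int q n \<noteq> 0"
  shows "\<exists>S. \<forall>M. (\<Sum>y<M. poly P (q_int q y) * q ^ y) = q_int q M * poly S (q_int q M)"
proof -
  have "\<exists>S. \<forall>M. (\<Sum>y<M. poly P (q_int q y) * q ^ y) = q_int q M * poly S (q_int q M)"
    if "\<And>i. i \<ge> n \<Longrightarrow> coeff P i = 0" for n P
    using that
  proof (induction n arbitrary: P)
    case 0
    then have "P = 0"
      by (simp add: poly_eq_iff)
    then show ?case
      by (auto intro!: exI[of _ 0])
  next
    case (Suc n)
    \<comment> \<open>The quotient \<open>(Y^(n+1) - X^(n+1)) / (Y - X)\<close> at
      \<open>Y = 1 + q X\<close>.\<close>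
    define R where "R = (\<Sum>k\<le>n. monom 1 (n - k) * [:1, q:] ^ k)"
    have coeff_R: "coeff R (n + j) = (if j = 0 then q_int q (Suc n) else 0)" for j
    proof -
      have "coeff (monom 1 (n - k) * [:1, q:] ^ k) (n + j) = (if j = 0 then q ^ k else 0)" if "k \<le> n" for k
      proof -
        have "coeff (monom 1 (n - k) * [:1, q:] ^ k) (n + j) = coeff ([:1, q:] ^ k) (k + j)"
          using that by (auto simp: coeff_monom_mult add.commute)
        then show ?thesis
          by (simp only: coeff_linear_power_top)
      qed
      then show ?thesis
        unfolding R_def coeff_sum q_int_def by (simp add: lessThan_Suc_atMost del: sum.lessThan_Suc)
    qed
    have "(\<Sum>y<M. poly R (q_int q y) * q ^ y) = q_int q M ^ Suc n" for M
    proof -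
      have "poly R (q_int q y) * q ^ y = q_int q (Suc y) ^ Suc n - q_int q y ^ Suc n" for y
      proof -
        have "q_int q (Suc y) - q_int q y = q ^ y"
          by (simp add: q_int_def)
        moreover have "poly R (q_int q y) = (\<Sum>k<Suc n. q_int q (Suc y) ^ k * q_int q y ^ (n - k))"
          by (simp add: R_def poly_sum poly_monom q_int_Suc lessThan_Suc_atMost mult.commute del: sum.lessThan_Suc)
        ultimately show ?thesis
          unfolding diff_power_eq_sum by simp
      qed
      then show ?thesis
        using sum_lessThan_telescope[of "\<lambda>y. q_int q y ^ Suc n" M] by simp
    qed
    note sum_R = this
    \<comment> \<open>Chosen so that subtracting \<open>smult a R\<close> cancels the coefficient of
      degree \<open>n\<close>.\<close>
    define a where "a = coeff P n / q_int q (Suc n)"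
    have "coeff (P - smult a R) i = 0" if "i \<ge> n" for i
      using Suc.prems[of i] coeff_R[of "i - n"] assms[of "Suc n"] that
      by (cases "i = n") (auto simp: a_def)
    then obtain S where S: "\<And>M. (\<Sum>y<M. poly (P - smult a R) (q_int q y) * q ^ y) = q_int q M * poly S (q_int q M)"
      using Suc.IH by blast
    have "(\<Sum>y<M. poly P (q_int q y) * q ^ y) = q_int q M * poly (S + monom a n) (q_int q M)" for M
    proof -
      have "(\<Sum>y<M. poly P (q_int q y) * q ^ y) =
          (\<Sum>y<M. poly (P - smult a R) (q_int q y) * q ^ y) + a * (\<Sum>y<M. poly R (q_int q y) * q ^ y)"
        unfolding sum_distrib_left sum.distrib[symmetric] by (simp add: algebra_simps)
      then show ?thesis
        unfolding S sum_R by (simp add: poly_monom algebra_simps)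
    qed
    then show ?case
      by blast
  qed
  from this[of "Suc (degree P)" P] show ?thesis
    by (simp add: coeff_eq_0)
qed

lemma sum_lessThan_mult:
  fixes g :: "nat \<Rightarrow> 'a::comm_monoid_add"
  shows "(\<Sum>z<n * k. g z) = (\<Sum>j<n. \<Sum>y<k. g (y + j * k))"
proof -
  have "sum g {j * k..<j * k + k} = (\<Sum>y<k. g (y + j * k))" for j
    by (rule sum.reindex_bij_witness[of _ "\<lambda>y. y + j * k" "\<lambda>z. z - j * k"]) auto
  then show ?thesis
    by (simp flip: sum.nat_group)
qed

context padic_field
begin

section \<open>q-powers and q-numbers\<close>

lemma vabs_base_eq_1:
  assumes "vabs (q - 1 :: 'a) < r"
  shows "vabs q = 1"
  using vabs_add_eq_right[of "q - 1" 1] assms r_less_1 by simp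

lemma vabs_base_power_less:
  assumes "vabs (q - 1 :: 'a) < r"
  shows "vabs (q ^ m - 1) < r"
  using vabs_power_diff_le[of q 1 m] vabs_base_eq_1[OF assms] assms by simp

lemma vabs_log_base:
  assumes "vabs (q - 1 :: 'a) < r"
  shows "vabs (padic_log q) = vabs (q - 1)"
  using vabs_padic_log[OF assms] by simp

lemma padic_exp_log_base:
  assumes "vabs (q - 1 :: 'a) < r"
  shows "padic_exp (padic_log q) = q"
  using padic_exp_log[OF assms] by simp

lemma padic_exponent_less:
  assumes "vabs (q - 1 :: 'a) < r" "vabs x \<le> 1"
  shows "vabs (x * padic_log q) < r"
  using assms vabs_log_base[OF assms(1)] mult_left_le_one_le[of "vabs (q - 1)" "vabs x"]
  by (simp add: vabs_mult)

lemma padic_power_of_nat: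
  assumes "vabs (q - 1 :: 'a) < r"
  shows "padic_power q (of_nat n) = q ^ n"
  using assms padic_exp_of_nat_mult[of "padic_log q" n]
  by (simp add: padic_power_def vabs_log_base padic_exp_log_base)

text \<open>The condition is on \<open>x * padic_log q\<close> because the argument
  \<open>(x + i) / m\<close> for base \<open>q ^ m\<close> may leave the unit ball when
  \<open>p\<close> divides \<open>m\<close>.\<close>

lemma padic_power_add_of_nat:
  assumes "vabs (q - 1 :: 'a) < r" "vabs (x * padic_log q) < r"
  shows "padic_power q (x + of_nat n) = padic_power q x * q ^ n"
  unfolding padic_power_of_nat[OF assms(1), symmetric] padic_power_def distrib_right
  by (intro padic_exp_add assms padic_exponent_less) simp

text \<open>Both sides lie in the disc where the exponential is injective, and both exponentiate to
  \<open>q ^ m\<close>.\<close>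

lemma padic_log_power:
  assumes "vabs (q - 1 :: 'a) < r"
  shows "padic_log (q ^ m) = of_nat m * padic_log q"
proof (rule padic_exp_inject)
  show "vabs (padic_log (q ^ m)) < r"
    using vabs_log_base vabs_base_power_less[OF assms] by simp
  show "vabs (of_nat m * padic_log q) < r"
    using padic_exponent_less[OF assms, of "of_nat m"] by simp
  show "padic_exp (padic_log (q ^ m)) = padic_exp (of_nat m * padic_log q)"
    using padic_power_of_nat[OF assms, of m]
    by (simp add: padic_exp_log_base vabs_base_power_less assms padic_power_def)
qed

lemma vabs_padic_power_minus_1:
  assumes "vabs (q - 1 :: 'a) < r" "vabs (x * padic_log q) < r"
  shows "vabs (padic_power q x - 1) = vabs x * vabs (q - 1)"
  using vabs_padic_exp_minus_1[OF assms(2)] vabs_log_base[OF assms(1)]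
  by (simp add: padic_power_def vabs_mult)

text \<open>\<open>q ^ n - 1 = exp (n log q) - 1\<close> has size \<open>|n| |q - 1|\<close>; divide
  by \<open>|q - 1|\<close>.\<close>

lemma vabs_q_int:
  assumes "vabs (q - 1 :: 'a) < r"
  shows "vabs (q_int q n) = vabs (of_nat n :: 'a)"
proof (cases "q = 1")
  case False
  have "vabs (q - 1) * vabs (q_int q n) = vabs (q ^ n - 1)"
    by (simp add: power_eq_q_int[of q n] vabs_mult)
  also have "\<dots> = vabs (of_nat n :: 'a) * vabs (q - 1)"
    using vabs_padic_power_minus_1[OF assms padic_exponent_less[OF assms], of "of_nat n"]
    by (simp add: padic_power_of_nat[OF assms])
  finally show ?thesis
    using False by (simp add: mult.commute)
qed simp

lemma q_int_nonzero:
  assumes "vabs (q - 1 :: 'a) < r" "n > 0"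
  shows "q_int q n \<noteq> 0"
  using vabs_q_int[OF assms(1), of n] assms(2) by (metis of_nat_eq_0_iff not_gr_zero vabs_eq_0_iff)

lemma padic_power_base_1 [simp]: "padic_power (1 :: 'a) x = 1"
  using vabs_log_base[of 1] r_pos by (simp add: padic_power_def padic_exp_0)

text \<open>Makes the integrand a polynomial in \<open>[y]\<close>, the form that
  \<open>q_sum_polynomial\<close> expects.\<close>

lemma q_number_add_of_nat:
  assumes "vabs (q - 1 :: 'a) < r" "vabs (x * padic_log q) < r"
  shows "q_number q (x + of_nat y) = q_number q x + padic_power q x * q_int q y"
proof (cases "q = 1")
  case False
  then show ?thesis
    unfolding q_number_def padic_power_add_of_nat[OF assms] power_eq_q_int[of q y]
    by (simp add: field_simps)
qed (simp add: q_number_def)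

lemma q_number_of_nat:
  assumes "vabs (q - 1 :: 'a) < r"
  shows "q_number q (of_nat n) = q_int q n"
  using q_number_add_of_nat[OF assms, of 0 n] r_pos
  by (simp add: q_number_def padic_power_def padic_exp_0)

section \<open>Limits of Riemann sums and the distribution relation\<close>

lemma q_number_sum_polynomial:
  assumes "vabs (q - 1 :: 'a) < r" "vabs (x * padic_log q) < r"
  shows "\<exists>S. \<forall>M. (\<Sum>y<M. q_number q (x + of_nat y) ^ l * q ^ y) = q_int q M * poly S (q_int q M)"
  using q_sum_polynomial[OF q_int_nonzero[OF assms(1)], of "[:q_number q x, padic_power q x:] ^ l"]
  by (simp add: q_number_add_of_nat[OF assms] poly_power mult.commute)

text \<open>Each normalized sum equals \<open>poly S [M]\<close>, and \<open>[M]\<close> is as small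
  as \<open>M\<close>. So the limit is \<open>poly S 0\<close> along every such sequence, including
  \<open>p ^ N\<close> from the definition.\<close>

lemma carlitz_q_bernoulli_LIMSEQ:
  assumes q: "vabs (q - 1 :: 'a) < r" and x: "vabs (x * padic_log q) < r"
    and M: "\<And>N. M N > 0" "(\<lambda>N. of_nat (M N) :: 'a) \<longlonglongrightarrow> 0"
  shows "(\<lambda>N. 1 / q_int q (M N) * (\<Sum>y<M N. q_number q (x + of_nat y) ^ l * q ^ y))
           \<longlonglongrightarrow> carlitz_q_bernoulli p l q x"
proof -
  obtain S where S: "\<And>M. (\<Sum>y<M. q_number q (x + of_nat y) ^ l * q ^ y) = q_int q M * poly S (q_int q M)"
    using q_number_sum_polynomial[OF q x] by blast
  have lim: "(\<lambda>N. 1 / q_int q (M N) * (\<Sum>y<M N. q_number q (x + of_nat y) ^ l * q ^ y)) \<longlonglongrightarrow> poly S 0"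
    if M: "\<And>N. M N > 0" "(\<lambda>N. of_nat (M N) :: 'a) \<longlonglongrightarrow> 0" for M
  proof -
    have "(\<lambda>N. q_int q (M N)) \<longlonglongrightarrow> 0"
      using M(2) by (subst (asm) tendsto_vabs_zero_iff[symmetric], subst tendsto_vabs_zero_iff[symmetric])
        (simp add: vabs_q_int[OF q])
    then have "(\<lambda>N. poly S (q_int q (M N))) \<longlonglongrightarrow> poly S 0"
      by (rule tendsto_poly_nonarch)
    then show ?thesis
      using q_int_nonzero[OF q] M(1) unfolding S by simp
  qed
  have "carlitz_q_bernoulli p l q x = poly S 0"
    unfolding carlitz_q_bernoulli_def padic_q_integral_def q_number_of_nat[OF q] atLeast0LessThan
    using p_gt_1 by (intro limI lim p_power_tendsto_0) simp
  then show ?thesis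
    using lim[OF M] by simp
qed

text \<open>As \<open>log (q^m) = m log q\<close>, base \<open>q^m\<close> at \<open>z / m\<close>
  gives the same power as \<open>q\<close> at \<open>z\<close>; only the denominators differ, by
  \<open>[m]\<close>.\<close>

lemma q_number_power_base:
  assumes q: "vabs (q - 1 :: 'a) < r" and "m > 0"
  shows "q_number (q ^ m) (z / of_nat m) = q_number q z / q_int q m"
proof (cases "q = 1")
  case False
  have nz: "q_int q m \<noteq> 0"
    by (rule q_int_nonzero[OF assms])
  have "padic_power (q ^ m) (z / of_nat m) = padic_power q z"
    using \<open>m > 0\<close> by (simp add: padic_power_def padic_log_power[OF q])
  moreover have "1 - q ^ m = (1 - q) * q_int q m"
    by (simp add: power_eq_q_int[of q m] algebra_simps)
  moreover from this have "q ^ m \<noteq> 1"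
    using False nz by auto
  ultimately show ?thesis
    using False by (simp add: q_number_def)
qed (simp add: q_number_def)

lemma carlitz_q_bernoulli_distribution:
  assumes q: "vabs (q - 1 :: 'a) < r" and x: "vabs x \<le> 1" and m: "m > 0"
  shows "carlitz_q_bernoulli p l q x =
    (\<Sum>i<m. q_int q m powi (int l - 1) * q ^ i * carlitz_q_bernoulli p l (q ^ m) ((x + of_nat i) / of_nat m))"
proof (rule LIMSEQ_unique)
  let ?Q = "q ^ m"
  let ?X = "\<lambda>i. (x + of_nat i) / of_nat m :: 'a"
  let ?F = "\<lambda>i N. 1 / q_int ?Q (p ^ N) * (\<Sum>y<p ^ N. q_number ?Q (?X i + of_nat y) ^ l * ?Q ^ y)"
  let ?c = "q_int q m powi (int l - 1)"
  have Q: "vabs (?Q - 1) < r"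
    by (rule vabs_base_power_less[OF q])
  have nz: "q_int q m \<noteq> 0"
    by (rule q_int_nonzero[OF q m])
  show "(\<lambda>N. \<Sum>i<m. ?c * q ^ i * ?F i N) \<longlonglongrightarrow> (\<Sum>i<m. ?c * q ^ i * carlitz_q_bernoulli p l ?Q (?X i))"
  proof (intro tendsto_sum tendsto_mult tendsto_const carlitz_q_bernoulli_LIMSEQ Q p_power_tendsto_0)
    fix i
    \<comment> \<open>The factor \<open>m\<close> in \<open>log (q^m)\<close> cancels the division
      by \<open>m\<close>.\<close>
    have "vabs ((x + of_nat i) * padic_log q) < r"
      using x by (intro padic_exponent_less q vabs_add_le) auto
    then show "vabs (?X i * padic_log ?Q) < r"
      using m by (simp add: padic_log_power[OF q])
  qed (use p_gt_1 in simp)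
  have "(\<lambda>N. 1 / q_int q (p ^ N * m) * (\<Sum>z<p ^ N * m. q_number q (x + of_nat z) ^ l * q ^ z)) \<longlonglongrightarrow>
      carlitz_q_bernoulli p l q x"
  proof (rule carlitz_q_bernoulli_LIMSEQ[OF q padic_exponent_less[OF q x]])
    show "(\<lambda>N. of_nat (p ^ N * m) :: 'a) \<longlonglongrightarrow> 0"
      using tendsto_mult[OF p_power_tendsto_0 tendsto_const[of "of_nat m"]] by simp
  qed (use p_gt_1 m in simp)
  \<comment> \<open>Substitute \<open>z = i + y m\<close>. The integrand yields
    \<open>[m]^l\<close>, and \<open>[p^N m]\<close> contains a factor \<open>[m]\<close>, whence
    the exponent \<open>l - 1\<close>.\<close>
  moreover have "1 / q_int q (p ^ N * m) * (\<Sum>z<p ^ N * m. q_number q (x + of_nat z) ^ l * q ^ z) =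
      (\<Sum>i<m. ?c * q ^ i * ?F i N)" for N
  proof -
    have num: "q_number q (x + of_nat (i + y * m)) = q_int q m * q_number ?Q (?X i + of_nat y)" for i y
    proof -
      have "?X i + of_nat y = (x + of_nat (i + y * m)) / of_nat m"
        using m by (simp add: field_simps)
      then show ?thesis
        using nz q_number_power_base[OF q m, of "x + of_nat (i + y * m)"] by simp
    qed
    have "(\<Sum>z<p ^ N * m. q_number q (x + of_nat z) ^ l * q ^ z) =
        (\<Sum>i<m. \<Sum>y<p ^ N. q_number q (x + of_nat (i + y * m)) ^ l * q ^ (i + y * m))"
      unfolding sum_lessThan_mult by (rule sum.swap)
    also have "\<dots> = (\<Sum>i<m. q_int q m ^ l * q ^ i * (\<Sum>y<p ^ N. q_number ?Q (?X i + of_nat y) ^ l * ?Q ^ y))"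
      unfolding num sum_distrib_left
      by (intro sum.cong refl) (simp add: power_mult_distrib power_add power_mult mult.commute[of _ m])
    finally show ?thesis
      using nz by (simp add: mult.commute[of _ m] q_int_mult sum_distrib_left power_int_diff mult_ac)
  qed
  ultimately show "(\<lambda>N. \<Sum>i<m. ?c * q ^ i * ?F i N) \<longlonglongrightarrow> carlitz_q_bernoulli p l q x"
    by simp
qed

section \<open>Uniform bounds and termwise integration\<close>

text \<open>Successive Riemann sums differ by at most \<open>p\<close>: the Lipschitz condition
  bounds the numerator by \<open>p^(-N)\<close>, while \<open>[p^(N+1)]\<close> has size
  \<open>p^(-N-1)\<close>. The ultrametric inequality keeps the bound through the induction.\<close>

lemma vabs_q_riemann_sum_le:
  fixes f :: "nat \<Rightarrow> 'a"
  assumes q: "vabs (q - 1) < r" and f: "\<And>y. vabs (f y) \<le> 1"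
    and lipschitz: "\<And>y k. vabs (f (y + k) - f y) \<le> vabs (of_nat k :: 'a)"
  shows "vabs (1 / q_int q (p ^ N) * (\<Sum>y<p ^ N. f y * q ^ y)) \<le> real p"
proof (induction N)
  case 0
  show ?case
    using f[of 0] p_gt_1 by simp
next
  case (Suc N)
  let ?I = "\<lambda>N. 1 / q_int q (p ^ N) * (\<Sum>y<p ^ N. f y * q ^ y)"
  let ?k = "p ^ N"
  let ?D = "\<Sum>j<p. \<Sum>y<?k. (f (y + j * ?k) - f y) * q ^ (y + j * ?k)"
  have nz: "q_int q ?k \<noteq> 0" "q_int (q ^ ?k) p \<noteq> 0"
    using q_int_nonzero[OF q, of ?k] q_int_nonzero[OF vabs_base_power_less[OF q, of ?k], of p] p_gt_1
    by auto
  have split: "q_int q (p ^ Suc N) = q_int q ?k * q_int (q ^ ?k) p"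
    by (simp add: q_int_mult mult.commute[of p] del: of_nat_power)
  \<comment> \<open>Replacing \<open>f (y + j p^N)\<close> by \<open>f y\<close> at level
    \<open>N + 1\<close> recovers the sum of level \<open>N\<close>, since \<open>q^(j p^N)\<close>
    summed over \<open>j\<close> is the missing q-integer factor.\<close>
  have "(\<Sum>j<p. \<Sum>y<?k. f y * q ^ (y + j * ?k)) = (\<Sum>y<?k. f y * q ^ y) * q_int (q ^ ?k) p"
    unfolding q_int_def sum_product by (subst sum.swap) (simp add: power_add mult.commute[of _ ?k] power_mult mult.assoc)
  then have "?I N = 1 / q_int q (p ^ Suc N) * (\<Sum>j<p. \<Sum>y<?k. f y * q ^ (y + j * ?k))"
    using nz unfolding split by simp
  moreover have "?I (Suc N) = 1 / q_int q (p ^ Suc N) * (\<Sum>j<p. \<Sum>y<?k. f (y + j * ?k) * q ^ (y + j * ?k))"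
    by (simp add: sum_lessThan_mult)
  ultimately have diff: "?I (Suc N) = 1 / q_int q (p ^ Suc N) * ?D + ?I N"
    by (simp add: sum_subtractf left_diff_distrib right_diff_distrib)
  have "vabs ?D \<le> 1 / real p ^ N"
  proof (intro vabs_sum_le)
    fix j y
    have "vabs (f (y + j * ?k) - f y) \<le> vabs (of_nat (j * ?k) :: 'a)"
      by (rule lipschitz)
    also have "\<dots> \<le> vabs (of_nat ?k :: 'a)"
      by (simp add: vabs_mult mult_left_le_one_le del: of_nat_power)
    finally show "vabs ((f (y + j * ?k) - f y) * q ^ (y + j * ?k)) \<le> 1 / real p ^ N"
      by (simp add: vabs_mult vabs_power vabs_base_eq_1[OF q] vabs_p_power del: of_nat_power)
  qed simp_all
  then have "real p ^ Suc N * vabs ?D \<le> real p ^ Suc N * (1 / real p ^ N)"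
    by (intro mult_left_mono) simp_all
  then have "vabs (1 / q_int q (p ^ Suc N) * ?D) \<le> real p"
    using p_gt_1 by (simp add: vabs_mult[of _ ?D] vabs_divide vabs_q_int[OF q] vabs_p_power del: of_nat_power power_Suc)
      (simp add: field_simps)
  then show ?case
    unfolding diff using Suc.IH by (rule vabs_add_le)
qed

lemma vabs_q_number_le_1:
  assumes q: "vabs (q - 1 :: 'a) < r" and x: "vabs x \<le> 1"
  shows "vabs (q_number q x) \<le> 1"
proof (cases "q = 1")
  case False
  have "vabs (1 - padic_power q x) = vabs x * vabs (1 - q)"
    using vabs_padic_power_minus_1[OF q padic_exponent_less[OF q x]]
    by (simp add: vabs_minus_commute[of 1])
  then show ?thesis
    using False x by (simp add: q_number_def vabs_divide)
qed (use x in \<open>simp add: q_number_def\<close>)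

text \<open>Shifting \<open>y\<close> by \<open>k\<close> changes the q-number by
  \<open>q^x q^y [k]\<close>, of size \<open>|k|\<close>, and powers within the unit ball do not
  enlarge differences. Hence the bound is uniform in \<open>l\<close>.\<close>

lemma vabs_carlitz_riemann_sum_le:
  assumes q: "vabs (q - 1 :: 'a) < r" and x: "vabs x \<le> 1"
  shows "vabs (1 / q_int q (p ^ N) * (\<Sum>y<p ^ N. q_number q (x + of_nat y) ^ l * q ^ y)) \<le> real p"
proof (rule vabs_q_riemann_sum_le[OF q])
  have le_1: "vabs (q_number q (x + of_nat y)) \<le> 1" for y
    using x by (intro vabs_q_number_le_1[OF q] vabs_add_le) auto
  then show "vabs (q_number q (x + of_nat y) ^ l) \<le> 1" for y
    by (simp add: vabs_power power_le_one)
  fix y k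
  note x' = padic_exponent_less[OF q x]
  have "q_number q (x + of_nat (y + k)) - q_number q (x + of_nat y) =
      padic_power q x * q ^ y * q_int q k"
    unfolding q_number_add_of_nat[OF q x'] q_int_add by (simp add: algebra_simps)
  moreover have "vabs (padic_power q x) = 1"
    unfolding padic_power_def by (rule vabs_padic_exp[OF x'])
  ultimately have "vabs (q_number q (x + of_nat (y + k)) - q_number q (x + of_nat y)) = vabs (of_nat k :: 'a)"
    by (simp add: vabs_mult vabs_power vabs_base_eq_1[OF q] vabs_q_int[OF q])
  with vabs_power_diff_le[OF le_1 le_1, of "y + k" l y]
  show "vabs (q_number q (x + of_nat (y + k)) ^ l - q_number q (x + of_nat y) ^ l) \<le> vabs (of_nat k :: 'a)"
    by simp
qed

lemma vabs_carlitz_q_bernoulli_le: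
  assumes q: "vabs (q - 1 :: 'a) < r" and x: "vabs x \<le> 1"
  shows "vabs (carlitz_q_bernoulli p l q x) \<le> real p"
proof (rule vabs_limit_le)
  show "(\<lambda>N. 1 / q_int q (p ^ N) * (\<Sum>y<p ^ N. q_number q (x + of_nat y) ^ l * q ^ y)) \<longlonglongrightarrow>
      carlitz_q_bernoulli p l q x"
    using p_gt_1 by (intro carlitz_q_bernoulli_LIMSEQ q padic_exponent_less x p_power_tendsto_0) simp
qed (simp only: vabs_carlitz_riemann_sum_le[OF q x] eventually_True)

text \<open>At each level \<open>N\<close> the Riemann sum of the exponential is a series in
  \<open>l\<close>, dominated by \<open>p |z^l / l!|\<close> independently of \<open>N\<close>;
  dominated convergence gives the integral.\<close>

lemma q_integral_exp_sums:
  assumes q: "vabs (q - 1 :: 'a) < r" and x: "vabs x \<le> 1" and z: "vabs z < r"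
  shows "(\<lambda>l. carlitz_q_bernoulli p l q x * (z ^ l / fact l)) sums
    padic_q_integral p q (\<lambda>y. padic_exp (q_number q (x + y) * z))"
proof -
  let ?J = "\<lambda>N l. 1 / q_int q (p ^ N) * (\<Sum>y<p ^ N. q_number q (x + of_nat y) ^ l * q ^ y)"
  let ?I = "\<lambda>N. 1 / q_int q (p ^ N) * (\<Sum>y<p ^ N. padic_exp (q_number q (x + of_nat y) * z) * q ^ y)"
  let ?d = "\<lambda>l. carlitz_q_bernoulli p l q x * (z ^ l / fact l)"
  have "(\<lambda>l. vabs (z ^ l / fact l)) \<longlonglongrightarrow> 0"
    unfolding tendsto_vabs_zero_iff by (rule exp_term_tendsto_0[OF z])
  from tendsto_mult[OF tendsto_const[of "real p"] this]
  have g: "(\<lambda>l. real p * vabs (z ^ l / fact l)) \<longlonglongrightarrow> 0"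
    by simp
  have "(\<lambda>l. vabs (?d l)) \<longlonglongrightarrow> 0"
  proof (rule tendsto_sandwich[OF _ _ tendsto_const g])
    have "vabs (?d l) \<le> real p * vabs (z ^ l / fact l)" for l
      unfolding vabs_mult[of "carlitz_q_bernoulli p l q x"]
      by (intro mult_right_mono vabs_carlitz_q_bernoulli_le q x) simp
    then show "\<forall>\<^sub>F l in sequentially. vabs (?d l) \<le> real p * vabs (z ^ l / fact l)"
      by simp
  qed simp
  then have d: "?d sums suminf ?d"
    unfolding tendsto_vabs_zero_iff by (intro summable_sums summable_nonarch complete_UNIV)
  have "?I \<longlonglongrightarrow> suminf ?d"
  proof (rule tendsto_sums_dominated[OF _ d _ g])
    show "(\<lambda>l. ?J N l * (z ^ l / fact l)) sums ?I N" for N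
    proof -
      have "(\<lambda>l. (q_number q (x + of_nat y) * z) ^ l / fact l) sums padic_exp (q_number q (x + of_nat y) * z)" for y
      proof (rule padic_exp_sums)
        have "vabs (q_number q (x + of_nat y)) \<le> 1"
          using x by (intro vabs_q_number_le_1[OF q] vabs_add_le) auto
        then show "vabs (q_number q (x + of_nat y) * z) < r"
          using z mult_left_le_one_le[of "vabs z" "vabs (q_number q (x + of_nat y))"]
          by (simp add: vabs_mult)
      qed
      from sums_mult_nonarch[OF this]
      have "(\<lambda>l. q ^ y * ((q_number q (x + of_nat y) * z) ^ l / fact l)) sums
          (padic_exp (q_number q (x + of_nat y) * z) * q ^ y)" for y
        by (simp only: mult.commute[of _ "q ^ y"])
      then have "(\<lambda>l. 1 / q_int q (p ^ N) * (\<Sum>y<p ^ N. q ^ y * ((q_number q (x + of_nat y) * z) ^ l / fact l))) sums ?I N"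
        by (intro sums_mult_nonarch sums_sum)
      then show ?thesis
        by (simp add: sum_distrib_left sum_distrib_right power_mult_distrib mult_ac sum_divide_distrib)
    qed
    show "vabs (?J N l * (z ^ l / fact l)) \<le> real p * vabs (z ^ l / fact l)" for N l
      unfolding vabs_mult[of "?J N l"]
      by (intro mult_right_mono vabs_carlitz_riemann_sum_le q x) simp
    show "(\<lambda>N. ?J N l * (z ^ l / fact l)) \<longlonglongrightarrow> ?d l" for l
      using p_gt_1
      by (intro tendsto_mult tendsto_const carlitz_q_bernoulli_LIMSEQ q padic_exponent_less x p_power_tendsto_0) simp
  qed
  then have "padic_q_integral p q (\<lambda>y. padic_exp (q_number q (x + y) * z)) = suminf ?d"
    unfolding padic_q_integral_def q_number_of_nat[OF q] atLeast0LessThan by (rule limI)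
  then show ?thesis
    using d by simp
qed

section \<open>The degenerate generating function and its coefficients\<close>

lemma degenerate_generating_function:
  assumes q: "vabs (q - 1 :: 'a) < r" and x: "vabs x \<le> 1"
    and lam: "lam \<noteq> 0" and t: "vabs (lam * t) < r" "vabs t < r"
  shows "(\<lambda>n. (\<Sum>l\<le>n. of_int (signed_stirling1 n l) * lam ^ (n - l) * carlitz_q_bernoulli p l q x) * (t ^ n / fact n))
    sums padic_q_integral p q (\<lambda>y. padic_power (1 + lam * t) (1 / lam * q_number q (x + y)))"
proof -
  let ?\<beta> = "\<lambda>l. carlitz_q_bernoulli p l q x"
  let ?L = "padic_log (1 + lam * t)"
  \<comment> \<open>Below \<open>r\<close>, and \<open>?c ^ n\<close> bounds
    \<open>|lam|^(n-l) |t|^n\<close>: through \<open>|t|^n\<close> if \<open>|lam|\<close> is at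
    most 1, through \<open>|lam t|^n\<close> otherwise.\<close>
  let ?c = "max (vabs t) (vabs (lam * t))"
  \<comment> \<open>The logarithm is isometric, so this quotient has size
    \<open>|t|\<close>.\<close>
  have "vabs (?L / lam) < r"
    using vabs_padic_log[OF t(1)] t(2) lam by (simp add: vabs_divide vabs_mult)
  from q_integral_exp_sums[OF q x this]
  have sums: "(\<lambda>l. ?\<beta> l / lam ^ l * (?L ^ l / fact l)) sums
      padic_q_integral p q (\<lambda>y. padic_power (1 + lam * t) (1 / lam * q_number q (x + y)))"
    by (simp add: padic_power_def power_divide mult_ac)
  have "(\<lambda>n. (\<Sum>l\<le>n. of_int (signed_stirling1 n l) * (?\<beta> l / lam ^ l)) * ((lam * t) ^ n / fact n)) sums
      padic_q_integral p q (\<lambda>y. padic_power (1 + lam * t) (1 / lam * q_number q (x + y)))"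
  proof (rule stirling_transform_sums[OF t(1) _ _ sums,
        where g = "\<lambda>n. real p * (?c ^ n / vabs (fact n :: 'a))"])
    have "(\<lambda>n. real p * (?c ^ n / vabs (fact n :: 'a))) \<longlonglongrightarrow> real p * 0"
      using t by (intro tendsto_mult tendsto_const power_over_fact_tendsto_0) (auto simp: le_max_iff_disj)
    then show "(\<lambda>n. real p * (?c ^ n / vabs (fact n :: 'a))) \<longlonglongrightarrow> 0"
      by simp
    fix l n :: nat
    assume "l \<le> n"
    have "vabs lam ^ (n - l) * vabs t ^ n \<le> ?c ^ n"
    proof (cases "vabs lam \<le> 1")
      case True
      then have "vabs lam ^ (n - l) * vabs t ^ n \<le> 1 * vabs t ^ n"
        by (intro mult_right_mono power_le_one) auto
      also have "\<dots> \<le> ?c ^ n"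
        by (auto intro: power_mono)
      finally show ?thesis .
    next
      case False
      then have "vabs lam ^ (n - l) * vabs t ^ n \<le> vabs lam ^ n * vabs t ^ n"
        by (intro mult_right_mono power_increasing) auto
      also have "\<dots> = vabs (lam * t) ^ n"
        by (simp add: vabs_mult power_mult_distrib)
      also have "\<dots> \<le> ?c ^ n"
        by (auto intro: power_mono)
      finally show ?thesis .
    qed
    then have "vabs (?\<beta> l) * (vabs lam ^ (n - l) * vabs t ^ n) \<le> real p * ?c ^ n"
      using vabs_carlitz_q_bernoulli_le[OF q x, of l] by (intro mult_mono) auto
    then have "vabs (?\<beta> l) * (vabs lam ^ (n - l) * vabs t ^ n) / vabs (fact n :: 'a) \<le> real p * ?c ^ n / vabs (fact n :: 'a)"
      by (rule divide_right_mono) simp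
    moreover have "vabs (?\<beta> l / lam ^ l * (lam * t) ^ n / fact n) =
        vabs (?\<beta> l) * (vabs lam ^ (n - l) * vabs t ^ n) / vabs (fact n :: 'a)"
      using lam \<open>l \<le> n\<close> by (simp add: vabs_mult vabs_divide vabs_power power_mult_distrib power_diff)
    ultimately show "vabs (?\<beta> l / lam ^ l * (lam * t) ^ n / fact n) \<le> real p * (?c ^ n / vabs (fact n :: 'a))"
      by simp
  qed
  moreover have "(\<Sum>l\<le>n. of_int (signed_stirling1 n l) * (?\<beta> l / lam ^ l)) * ((lam * t) ^ n / fact n) =
      (\<Sum>l\<le>n. of_int (signed_stirling1 n l) * lam ^ (n - l) * ?\<beta> l) * (t ^ n / fact n)" for n
    unfolding sum_distrib_right
    by (intro sum.cong refl) (use lam in \<open>simp add: power_mult_distrib power_diff\<close>)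
  ultimately show ?thesis
    by simp
qed

text \<open>Evaluate at \<open>t = p^s p^j\<close>. Once the lower coefficients vanish, the term of
  degree \<open>k\<close> must balance the tail, which is smaller by a factor of order
  \<open>p^(-j)\<close>; then let \<open>j\<close> grow.\<close>

lemma power_series_eq_0_imp_coeff_eq_0:
  assumes "\<delta> > 0" and sums: "\<And>t :: 'a. vabs t < \<delta> \<Longrightarrow> (\<lambda>k. d k * t ^ k) sums 0"
  shows "d k = 0"
proof (induction k rule: less_induct)
  case (less k)
  have p0: "(\<lambda>j. 1 / real p ^ j) \<longlonglongrightarrow> 0"
    using p_power_tendsto_0 unfolding tendsto_vabs_zero_iff[symmetric] vabs_p_power .
  then have "\<forall>\<^sub>F j in sequentially. 1 / real p ^ j < \<delta>"
    using \<open>\<delta> > 0\<close> by (rule order_tendstoD)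
  then obtain s where s: "1 / real p ^ s < \<delta>"
    unfolding eventually_sequentially by blast
  let ?t = "of_nat (p ^ s) :: 'a"
  let ?e = "\<lambda>k. d k * ?t ^ k"
  have u: "(\<lambda>k. ?e k * of_nat (p ^ j) ^ k) sums 0" for j
  proof -
    have "vabs (?t * of_nat (p ^ j)) \<le> vabs ?t"
      by (simp add: vabs_mult mult_left_le del: of_nat_power)
    also have "\<dots> < \<delta>"
      using s by (simp only: vabs_p_power)
    finally show ?thesis
      using sums[of "?t * of_nat (p ^ j)"] by (simp add: power_mult_distrib mult.assoc)
  qed
  have "?e sums 0"
    using u[of 0] by simp
  then obtain C where C: "0 < C" "\<And>n. vabs (?e n) \<le> C"
    using LIMSEQ_zero_vabs_bounded sums_imp_LIMSEQ_zero by blast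
  have "vabs (?e k) \<le> C * (1 / real p ^ j)" for j
  proof -
    let ?u = "1 / real p ^ j"
    have u1: "0 < ?u" "?u \<le> 1"
      using p_gt_1 by auto
    have "vabs (0 - (\<Sum>i<Suc k. ?e i * of_nat (p ^ j) ^ i)) \<le> C * ?u ^ Suc k"
    proof (rule vabs_sums_tail_le[OF u])
      fix i assume "Suc k \<le> i"
      then have "vabs (?e i) * ?u ^ i \<le> C * ?u ^ Suc k"
        using C u1 by (intro mult_mono power_decreasing) auto
      then show "vabs (?e i * of_nat (p ^ j) ^ i) \<le> C * ?u ^ Suc k"
        by (simp only: vabs_mult vabs_power[of "of_nat (p ^ j)"] vabs_p_power)
    qed (use C u1 in simp)
    also have "(\<Sum>i<Suc k. ?e i * of_nat (p ^ j) ^ i) = ?e k * of_nat (p ^ j) ^ k"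
      using less by simp
    finally have "vabs (?e k * of_nat (p ^ j) ^ k) \<le> C * ?u ^ Suc k"
      by (simp only: diff_0 vabs_minus)
    \<comment> \<open>The right side has one spare factor \<open>?u\<close>; after cancelling
      \<open>?u ^ k\<close> it makes the bound tend to 0.\<close>
    then have "vabs (?e k) * ?u ^ k \<le> C * ?u * ?u ^ k"
      unfolding vabs_mult[of "?e k"] vabs_power[of "of_nat (p ^ j)"] vabs_p_power power_Suc
      by (simp only: mult.assoc)
    then show ?thesis
      using u1(1) by (subst (asm) mult_le_cancel_right_pos) auto
  qed
  moreover have "(\<lambda>j. C * (1 / real p ^ j)) \<longlonglongrightarrow> C * 0"
    by (intro tendsto_mult tendsto_const p0)
  ultimately have "vabs (?e k) \<le> C * 0"
    by (intro LIMSEQ_le_const) auto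
  then show ?case
    using order_antisym[OF _ vabs_nonneg[of "?e k"]] p_gt_1 by simp
qed

text \<open>\<open>THE\<close> is resolved by the generating function for existence and by
  comparison of power series for uniqueness.\<close>

lemma degenerate_carlitz_q_bernoulli_eq:
  assumes q: "vabs (q - 1 :: 'a) < r" and x: "vabs x \<le> 1" and lam: "lam \<noteq> 0"
  shows "degenerate_carlitz_q_bernoulli p n q x lam =
    (\<Sum>l\<le>n. of_int (signed_stirling1 n l) * lam ^ (n - l) * carlitz_q_bernoulli p l q x)"
proof -
  let ?b = "\<lambda>n. \<Sum>l\<le>n. of_int (signed_stirling1 n l) * lam ^ (n - l) * carlitz_q_bernoulli p l q x"
  let ?I = "\<lambda>t. padic_q_integral p q (\<lambda>y. padic_power (1 + lam * t) (1 / lam * q_number q (x + y)))"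
  have unique: "b = ?b" if b: "\<forall>t. vabs (lam * t) < r \<and> vabs t < r \<longrightarrow> (\<lambda>k. b k * (t ^ k / fact k)) sums ?I t" for b
  proof
    fix k
    have "(b k - ?b k) / fact k = 0"
    proof (rule power_series_eq_0_imp_coeff_eq_0)
      \<comment> \<open>On a disc of this radius both \<open>|t| < r\<close> and
        \<open>|lam t| < r\<close> hold.\<close>
      show "min r (r / vabs lam) > 0"
        using r_pos lam by simp
      fix t :: 'a assume "vabs t < min r (r / vabs lam)"
      then have t: "vabs (lam * t) < r" "vabs t < r"
        using lam by (simp_all add: vabs_mult field_simps)
      then show "(\<lambda>k. (b k - ?b k) / fact k * t ^ k) sums 0"
        using sums_diff_nonarch[OF b[rule_format, OF conjI, OF t] degenerate_generating_function[OF q x lam t]]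
        by (simp add: left_diff_distrib diff_divide_distrib)
    qed
    then show "b k = ?b k"
      by simp
  qed
  let ?G = "\<lambda>b. \<forall>t. vabs (lam * t) < r \<and> vabs t < r \<longrightarrow> (\<lambda>k. b k * (t ^ k / fact k)) sums ?I t"
  have "?G ?b"
    by (intro allI impI degenerate_generating_function[OF q x lam]) simp_all
  then have "The ?G = ?b"
    by (rule the_equality[where P = ?G]) (rule unique)
  then show ?thesis
    unfolding degenerate_carlitz_q_bernoulli_def by simp
qed

end

section \<open>The distribution relation inserted into the Stirling expansion\<close>

theorem theorem8:
  fixes p n m :: nat and q lam x :: "'a::nonarch_field"
  assumes "prime p"
    and "padic_complex_field p TYPE('a)"
    and "vabs (q - 1) < real p powr (- 1 / (real p - 1))"
    and "lam \<noteq> 0"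
    and "x \<in> padic_integers"
    and "m \<ge> 1"
  shows "degenerate_carlitz_q_bernoulli p n q x lam =
    (\<Sum>l = 0..n. \<Sum>i = 0..<m.
       of_int (signed_stirling1 n l) * lam ^ (n - l) *
       q_number q (of_nat m) powi (int l - 1) * q ^ i *
       carlitz_q_bernoulli p l (q ^ m) ((x + of_nat i) / of_nat m))"
proof -
  interpret padic_field p "TYPE('a)"
    using assms(1,2) by unfold_locales (auto simp: padic_complex_field_def)
  have q: "vabs (q - 1) < conv_radius_exp p"
    using assms(3) by (simp add: conv_radius_exp_def)
  have x: "vabs x \<le> 1"
    using assms(5) by (simp add: padic_integers_def)
  have "carlitz_q_bernoulli p l q x =
      (\<Sum>i<m. q_int q m powi (int l - 1) * q ^ i * carlitz_q_bernoulli p l (q ^ m) ((x + of_nat i) / of_nat m))" for l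
    using assms(6) by (intro carlitz_q_bernoulli_distribution q x) simp
  then show ?thesis
    unfolding degenerate_carlitz_q_bernoulli_eq[OF q x assms(4)] q_number_of_nat[OF q]
    by (simp add: sum_distrib_left atLeast0AtMost atLeast0LessThan mult.assoc)
qed

end
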